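(* Let $K$ be a field, and suppose that $I$ and $J$ are square-free monomial ideals in $R=K[x_1,\ldots,x_n]$ such that $I=J+(x_\alpha x_\beta)$, where $1\leq \alpha\neq \beta\leq n$. Then the following statements hold: (i) if $J$ is normally torsion-free, then $J$ is a proper demotion of $I$; (ii) if both $I$ and $J$ are normally torsion-free, $h:=\prod_{i=1}^m x_{n+i}$ and $S=R[x_{n+1},\ldots,x_{n+m}]$, then $L:=JS+hx_\alpha x_\beta S$ is a normally torsion-free square-free monomial ideal in $S$.
   Context: Let $J\subseteq I$ be ideals in a commutative Noetherian ring $R$. $J$ is a demotion of $I$ if $I^rJ^s=I^{r+s}\cap J^s$ for all integers $r,s\geq 0$ (with $I^0=J^0=R$); it is a proper demotion of $I$ if $J$ is a demotion of $I$ and $I\neq J$. An ideal $I$ of a Noetherian ring $R$ is normally torsion-free if $\mathrm{Ass}_R(R/I^s)\subseteq \mathrm{Ass}_R(R/I)$ for all $s\geq 1$. A monomial ideal is square-free if it is generated by square-free monomials.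
   Formalization: In (i) it is additionally assumed that x_αx_β is not in J (equivalently I ≠ J); without this (i) fails, e.g. for I = J = (x_1x_2), where J is a demotion of I but not a proper one. *)

theory Defs
  imports "HOL-Algebra.Ideal_Product" "HOL-Algebra.QuotRing" "HOL-Algebra.Module"
    "HOL-Library.Poly_Mapping"
begin

section \<open>Polynomial rings in the first n variables\<close>

text \<open>
  A polynomial is a finitely supported map from exponent vectors to coefficients. The rings
  for different n live in the single type of polynomials in countably many variables, so that
  the extension of rings from n to n + m variables is an inclusion of carriers.
\<close>

type_synonym 'k mpoly = "(nat \<Rightarrow>\<^sub>0 nat) \<Rightarrow>\<^sub>0 'k"

definition var :: "nat \<Rightarrow> 'k::comm_ring_1 mpoly" where
  "var i = Poly_Mapping.single (Poly_Mapping.single i 1) 1"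

definition mpoly_ring :: "nat \<Rightarrow> 'k::comm_ring_1 mpoly ring" where
  "mpoly_ring n =
    \<lparr> carrier = {p. \<forall>t \<in> Poly_Mapping.keys p. Poly_Mapping.keys t \<subseteq> {1..n}},
      mult = (*), one = 1, zero = 0, add = (+) \<rparr>"

definition squarefree_monomials :: "nat \<Rightarrow> 'k::comm_ring_1 mpoly set" where
  "squarefree_monomials n = {\<Prod>i\<in>A. var i | A. A \<subseteq> {1..n}}"

definition squarefree_monomial_ideal :: "nat \<Rightarrow> 'k::comm_ring_1 mpoly set \<Rightarrow> bool" where
  "squarefree_monomial_ideal n I \<longleftrightarrow>
    (\<exists>G \<subseteq> squarefree_monomials n. I = genideal (mpoly_ring n) G)"


section \<open>Demotions and normally torsion-free ideals\<close>

abbreviation ideal_power :: "('a, 'b) ring_scheme \<Rightarrow> 'a set \<Rightarrow> nat \<Rightarrow> 'a set" where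
  "ideal_power R I k \<equiv> I [^]\<^bsub>ideals_set R\<^esub> k"

definition demotion :: "('a, 'b) ring_scheme \<Rightarrow> 'a set \<Rightarrow> 'a set \<Rightarrow> bool" where
  "demotion R J I \<longleftrightarrow> ideal J R \<and> ideal I R \<and> J \<subseteq> I \<and>
    (\<forall>r s :: nat. ideal_power R I r \<cdot>\<^bsub>R\<^esub> ideal_power R J s
                  = ideal_power R I (r + s) \<inter> ideal_power R J s)"

definition proper_demotion :: "('a, 'b) ring_scheme \<Rightarrow> 'a set \<Rightarrow> 'a set \<Rightarrow> bool" where
  "proper_demotion R J I \<longleftrightarrow> demotion R J I \<and> I \<noteq> J"

definition quotient_module :: "('a, 'b) ring_scheme \<Rightarrow> 'a set \<Rightarrow> ('a, 'a set) module" where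
  "quotient_module R I =
    \<lparr> carrier = carrier (R Quot I), mult = mult (R Quot I), one = one (R Quot I),
      zero = zero (R Quot I), add = add (R Quot I),
      smult = (\<lambda>r x. (I +>\<^bsub>R\<^esub> r) \<otimes>\<^bsub>R Quot I\<^esub> x) \<rparr>"

definition associated_primes ::
  "('a, 'b) ring_scheme \<Rightarrow> ('a, 'c, 'd) module_scheme \<Rightarrow> 'a set set" where
  "associated_primes R M =
    {P. primeideal P R \<and>
        (\<exists>x \<in> carrier M. P = {r \<in> carrier R. r \<odot>\<^bsub>M\<^esub> x = \<zero>\<^bsub>M\<^esub>})}"

definition normally_torsion_free :: "('a, 'b) ring_scheme \<Rightarrow> 'a set \<Rightarrow> bool" where
  "normally_torsion_free R I \<longleftrightarrow> ideal I R \<and>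
    (\<forall>s::nat. s \<ge> 1 \<longrightarrow>
      associated_primes R (quotient_module R (ideal_power R I s))
        \<subseteq> associated_primes R (quotient_module R I))"


section \<open>Basic facts\<close>

lemma ideal_power_0: "ideal_power R I 0 = carrier R"
  by (simp add: nat_pow_def ideals_set_def)

lemma ideal_power_Suc: "ideal_power R I (Suc k) = ideal_power R I k \<cdot>\<^bsub>R\<^esub> I"
  by (simp add: nat_pow_def ideals_set_def)

lemma mpoly_ring_mult_closed:
  fixes p q :: "'k::comm_ring_1 mpoly"
  assumes "p \<in> carrier (mpoly_ring n)" "q \<in> carrier (mpoly_ring n)"
  shows "p * q \<in> carrier (mpoly_ring n)"
proof -
  have "Poly_Mapping.keys t \<subseteq> {1..n}" if t: "t \<in> Poly_Mapping.keys (p * q)" for t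
  proof -
    obtain a b where "t = a + b" "a \<in> Poly_Mapping.keys p" "b \<in> Poly_Mapping.keys q"
      using t keys_mult[of p q] by blast
    then show ?thesis
      using assms Poly_Mapping.keys_add[of a b] by (force simp: mpoly_ring_def)
  qed
  then show ?thesis by (simp add: mpoly_ring_def)
qed

lemma cring_mpoly_ring: "cring (mpoly_ring n :: 'k::comm_ring_1 mpoly ring)"
proof (rule cringI)
  have add: "p + q \<in> carrier (mpoly_ring n)"
    if "p \<in> carrier (mpoly_ring n)" "q \<in> carrier (mpoly_ring n)" for p q :: "'k mpoly"
    using that Poly_Mapping.keys_add[of p q] by (force simp: mpoly_ring_def)
  show "abelian_group (mpoly_ring n :: 'k mpoly ring)"
  proof (rule abelian_groupI)
    fix p :: "'k mpoly" assume "p \<in> carrier (mpoly_ring n)"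
    then have "- p \<in> carrier (mpoly_ring n)" by (simp add: mpoly_ring_def)
    then show "\<exists>q \<in> carrier (mpoly_ring n). q \<oplus>\<^bsub>mpoly_ring n\<^esub> p = \<zero>\<^bsub>mpoly_ring n\<^esub>"
      by (intro bexI[of _ "- p"]) (simp_all add: mpoly_ring_def)
  next
    fix p q :: "'k mpoly"
    assume "p \<in> carrier (mpoly_ring n)" "q \<in> carrier (mpoly_ring n)"
    then have "p + q \<in> carrier (mpoly_ring n)" by (rule add)
    then show "p \<oplus>\<^bsub>mpoly_ring n\<^esub> q \<in> carrier (mpoly_ring n)" by (simp add: mpoly_ring_def)
  qed (simp_all add: mpoly_ring_def add_ac)
  show "comm_monoid (mpoly_ring n :: 'k mpoly ring)"
  proof (rule comm_monoidI)
    fix p q :: "'k mpoly"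
    assume "p \<in> carrier (mpoly_ring n)" "q \<in> carrier (mpoly_ring n)"
    then have "p * q \<in> carrier (mpoly_ring n)" by (rule mpoly_ring_mult_closed)
    then show "p \<otimes>\<^bsub>mpoly_ring n\<^esub> q \<in> carrier (mpoly_ring n)" by (simp add: mpoly_ring_def)
  qed (simp_all add: mpoly_ring_def algebra_simps)
qed (simp_all add: mpoly_ring_def algebra_simps)

lemma var_in_carrier: "i \<in> {1..n} \<Longrightarrow> var i \<in> carrier (mpoly_ring n)"
  by (auto simp: var_def mpoly_ring_def)

lemma mpoly_ring_carrier_mono: "carrier (mpoly_ring n) \<subseteq> carrier (mpoly_ring (n + m))"
  by (force simp: mpoly_ring_def)

lemma module_quotient_module:
  assumes "cring R" "ideal I R"
  shows "module R (quotient_module R I)"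
proof -
  interpret R: cring R by fact
  interpret I: ideal I R by fact
  interpret Q: cring "R Quot I" by (rule I.quotient_is_cring[OF \<open>cring R\<close>])
  interpret h: ring_hom_ring R "R Quot I" "(+>\<^bsub>R\<^esub>) I"
    by (rule I.rcos_ring_hom_ring)
  have "abelian_group (quotient_module R I)"
  proof (rule abelian_groupI)
    fix x assume "x \<in> carrier (quotient_module R I)"
    then show "\<exists>y \<in> carrier (quotient_module R I).
        y \<oplus>\<^bsub>quotient_module R I\<^esub> x = \<zero>\<^bsub>quotient_module R I\<^esub>"
      by (intro bexI[of _ "\<ominus>\<^bsub>R Quot I\<^esub> x"]) (simp_all add: quotient_module_def Q.l_neg)
  qed (simp_all add: quotient_module_def Q.a_assoc Q.a_comm Q.a_lcomm)
  moreover have "I +>\<^bsub>R\<^esub> r \<in> carrier (R Quot I)" if "r \<in> carrier R" for r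
    using h.hom_closed[OF that] .
  ultimately show ?thesis
    by (intro moduleI assms)
      (simp_all add: quotient_module_def Q.l_distr Q.r_distr Q.m_assoc)
qed

end

theory Submission
  imports Defs
begin

text \<open>
  A square-free monomial ideal \<open>J\<close> is determined by the supports of its generators, the \<open>edges\<close> of a
  hypergraph on the variables. All the ideals involved are spanned by monomials, so products, sums
  and intersections can be computed on sets of exponent vectors. The associated primes that matter
  are the primes \<open>P\<^sub>C\<close> generated by the variables in a set \<open>C\<close>; such a prime contains \<open>J\<close> if and only if
  \<open>C\<close> is a vertex cover, that is, meets every edge.

  The bridge between algebra and combinatorics is that \<open>J\<close> is normally torsion-free if and only if,
  for all \<open>k\<close>, every monomial whose degree in the variables of each cover is at least \<open>k\<close> lies in
  \<open>J\<^sup>k\<close>; in other words, \<open>J\<^sup>k\<close> is the intersection of the powers \<open>P\<^sub>C\<^sup>k\<close>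
  (\<open>torsion_free_if_normally_torsion_free\<close>, \<open>normally_torsion_free_if_torsion_free\<close>).
  One direction colons \<open>J\<^sup>k\<close> by a monomial that is as large as possible outside \<open>J\<^sup>k\<close>; the other
  uses that the \<open>P\<^sub>C\<^sup>k\<close> are primary.

  Now let \<open>I = J + (f)\<close> with a square-free monomial \<open>f\<close>, and let \<open>J\<close> be normally torsion-free. A monomial
  of \<open>I\<^sup>r\<^sup>+\<^sup>s \<inter> J\<^sup>s\<close> is \<open>u = f\<^sup>p v\<close> with \<open>v\<close> in \<open>J\<^sup>q\<close> and \<open>p + q = r + s\<close>. If \<open>q \<ge> s\<close>, it lies in
  \<open>I\<^sup>r J\<^sup>s\<close> at once. Otherwise \<open>p > r\<close>, and \<open>u / f\<^sup>r\<close> has degree at least \<open>s\<close> on every cover: on a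
  cover that misses \<open>f\<close> it has the same degree as \<open>u\<close>, and on the others its degree is at least
  \<open>(p - r) + q = s\<close>. Hence \<open>u / f\<^sup>r\<close> lies in \<open>J\<^sup>s\<close> (\<open>edge_power_insert_Int\<close>), which is the demotion.

  For the second part let \<open>u\<close> be a monomial of degree at least \<open>k\<close> on every cover of \<open>L = JS + (hf)\<close>,
  let \<open>u\<^sub>0\<close> be its part in the old variables and \<open>e\<close> the least of \<open>k\<close> and the exponents of the new
  variables in \<open>u\<close>. Covers of \<open>I\<close> are covers of \<open>L\<close>, so \<open>u\<^sub>0\<close> lies in \<open>I\<^sup>k\<close>. If \<open>e < k\<close>, a cover of \<open>J\<close>
  together with a new variable of exponent \<open>e\<close> is a cover of \<open>L\<close>; so in any case \<open>u\<^sub>0\<close> lies in \<open>J\<^sup>k\<^sup>-\<^sup>e\<close>. By the demotion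
  \<open>u\<^sub>0\<close> lies in \<open>I\<^sup>e J\<^sup>k\<^sup>-\<^sup>e\<close>, and \<open>h\<^sup>e I\<^sup>e\<close> is contained in \<open>L\<^sup>e\<close>; so \<open>u\<close> lies in \<open>L\<^sup>k\<close>
  (\<open>torsion_free_enlarge_edge\<close>).
\<close>

section \<open>Exponent vectors and powers of edges\<close>

abbreviation lookup where "lookup \<equiv> Poly_Mapping.lookup"
abbreviation keys where "keys \<equiv> Poly_Mapping.keys"

definition exponents :: "nat \<Rightarrow> (nat \<Rightarrow>\<^sub>0 nat) set" where
  "exponents n = {t. keys t \<subseteq> {1..n}}"

text \<open>The exponent vector of \<open>(\<Prod>i\<in>A. x\<^sub>i)\<^sup>e\<close>, for finite \<open>A\<close>.\<close>

definition expo :: "nat set \<Rightarrow> nat \<Rightarrow> (nat \<Rightarrow>\<^sub>0 nat)" where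
  "expo A e = (\<Sum>i\<in>A. Poly_Mapping.single i e)"

definition weight :: "nat set \<Rightarrow> (nat \<Rightarrow>\<^sub>0 nat) \<Rightarrow> nat" where
  "weight C t = (\<Sum>i\<in>C. lookup t i)"

definition edge_multiples :: "nat \<Rightarrow> nat set set \<Rightarrow> (nat \<Rightarrow>\<^sub>0 nat) set" where
  "edge_multiples n E = {t \<in> exponents n. \<exists>A\<in>E. A \<subseteq> keys t}"

text \<open>
  The exponents of the monomials in the \<open>k\<close>-th power of the ideal whose generators have the
  supports \<open>E\<close>.
\<close>

primrec edge_power :: "nat \<Rightarrow> nat set set \<Rightarrow> nat \<Rightarrow> (nat \<Rightarrow>\<^sub>0 nat) set" where
  "edge_power n E 0 = exponents n"
| "edge_power n E (Suc k) = {s + t | s t. s \<in> edge_power n E k \<and> t \<in> edge_multiples n E}"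

definition cover :: "nat \<Rightarrow> nat set set \<Rightarrow> nat set \<Rightarrow> bool" where
  "cover n E C \<longleftrightarrow> C \<subseteq> {1..n} \<and> (\<forall>A\<in>E. A \<inter> C \<noteq> {})"

text \<open>
  The combinatorial form of normal torsion-freeness: ordinary and symbolic powers of the edge
  ideal have the same monomials.
\<close>

definition torsion_free :: "nat \<Rightarrow> nat set set \<Rightarrow> bool" where
  "torsion_free n E \<longleftrightarrow>
    (\<forall>k. \<forall>t \<in> exponents n. (\<forall>C. cover n E C \<longrightarrow> k \<le> weight C t) \<longrightarrow> t \<in> edge_power n E k)"

lemma keys_add_nat: "keys (s + t) = keys s \<union> keys (t :: nat \<Rightarrow>\<^sub>0 nat)"
  by (auto simp: in_keys_iff lookup_add)

lemma exponents_add_iff [simp]: "s + t \<in> exponents n \<longleftrightarrow> s \<in> exponents n \<and> t \<in> exponents n"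
  by (simp add: exponents_def keys_add_nat)

lemma exponents_mono: "n \<le> n' \<Longrightarrow> exponents n \<subseteq> exponents n'"
  by (force simp: exponents_def)

lemma exponents_0 [simp]: "0 \<in> exponents n"
  by (simp add: exponents_def)

lemma lookup_expo: "finite A \<Longrightarrow> lookup (expo A e) i = (if i \<in> A then e else 0)"
  by (simp add: expo_def lookup_sum lookup_single when_def sum.delta)

lemma expo_add: "expo A (d + e) = expo A d + expo A e"
  by (simp add: expo_def single_add sum.distrib)

lemma keys_expo_subset: "finite A \<Longrightarrow> keys (expo A e) \<subseteq> A"
  by (auto simp: in_keys_iff lookup_expo split: if_splits)

lemma expo_in_exponents: "A \<subseteq> {1..n} \<Longrightarrow> expo A e \<in> exponents n"
  using keys_expo_subset[of A e] finite_subset[of A "{1..n}"] by (simp add: exponents_def)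

lemma weight_add: "weight C (s + t) = weight C s + weight C t"
  by (simp add: weight_def lookup_add sum.distrib)

lemma weight_expo:
  assumes "finite C" "finite A"
  shows "weight C (expo A e) = e * card (C \<inter> A)"
proof -
  have "weight C (expo A e) = (\<Sum>i\<in>C. if i \<in> A then e else 0)"
    by (simp add: weight_def lookup_expo assms)
  also have "\<dots> = (\<Sum>i\<in>C \<inter> A. e)"
    by (rule sum.inter_restrict[symmetric]) (rule assms)
  finally show ?thesis by simp
qed

lemma add_diff_exponent:
  fixes s t :: "nat \<Rightarrow>\<^sub>0 nat"
  assumes "\<And>i. lookup s i \<le> lookup t i"
  shows "s + (t - s) = t"
  using assms by (intro poly_mapping_eqI) (simp add: lookup_add lookup_minus)

lemma expo_add_diff:
  assumes "A \<subseteq> keys t"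
  shows "expo A 1 + (t - expo A 1) = t"
proof (rule add_diff_exponent)
  have "finite A" using assms finite_subset by fastforce
  then show "lookup (expo A 1) i \<le> lookup t i" for i
    using assms by (auto simp: lookup_expo in_keys_iff Suc_le_eq subset_eq)
qed

lemma edge_power_subset: "t \<in> edge_power n E k \<Longrightarrow> t \<in> exponents n"
  by (induction k arbitrary: t) (auto simp: edge_multiples_def)

lemma edge_power_up:
  "t \<in> edge_power n E k \<Longrightarrow> s \<in> exponents n \<Longrightarrow> t + s \<in> edge_power n E k"
proof (induction k arbitrary: t)
  case (Suc k)
  then obtain a b where "t = a + b" "a \<in> edge_power n E k" "b \<in> edge_multiples n E" by auto
  moreover have "t + s = (a + s) + b" using \<open>t = a + b\<close> by (simp add: algebra_simps)
  ultimately show ?case using Suc.IH Suc.prems(2) by auto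
qed simp

text \<open>
  The two factors in the recursive definition can be normalised: one of them may be taken to be
  a generator itself. This is the form in which all inductions on the power are carried out.
\<close>

lemma edge_power_Suc_iff:
  "t \<in> edge_power n E (Suc k) \<longleftrightarrow>
    t \<in> exponents n \<and> (\<exists>A\<in>E. A \<subseteq> keys t \<and> t - expo A 1 \<in> edge_power n E k)"
proof
  assume t: "t \<in> edge_power n E (Suc k)"
  then obtain a b A where ab: "t = a + b" "a \<in> edge_power n E k" "b \<in> exponents n"
    "A \<in> E" "A \<subseteq> keys b"
    by (auto simp: edge_multiples_def)
  have b: "expo A 1 + (b - expo A 1) = b" using ab(5) by (rule expo_add_diff)
  have "t - expo A 1 = a + (b - expo A 1)"
    using b ab(1) by (metis add.left_commute add_diff_cancel_left')
  moreover have "b - expo A 1 \<in> exponents n" using b ab(3) by (metis exponents_add_iff)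
  ultimately have "t - expo A 1 \<in> edge_power n E k" using ab(2) edge_power_up by simp
  moreover have "A \<subseteq> keys t" using ab by (auto simp: keys_add_nat)
  ultimately show "t \<in> exponents n \<and> (\<exists>A\<in>E. A \<subseteq> keys t \<and> t - expo A 1 \<in> edge_power n E k)"
    using ab(4) edge_power_subset[OF t] by blast
next
  assume "t \<in> exponents n \<and> (\<exists>A\<in>E. A \<subseteq> keys t \<and> t - expo A 1 \<in> edge_power n E k)"
  then obtain A where A: "t \<in> exponents n" "A \<in> E" "A \<subseteq> keys t"
    "t - expo A 1 \<in> edge_power n E k" by blast
  have eq: "expo A 1 + (t - expo A 1) = t" using A(3) by (rule expo_add_diff)
  have "A \<subseteq> keys (expo A 1)"
    using A(3) finite_subset[OF A(3)] by (auto simp: in_keys_iff lookup_expo)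
  moreover have "expo A 1 \<in> exponents n" using eq A(1) by (metis exponents_add_iff)
  ultimately have "expo A 1 \<in> edge_multiples n E" using A(2) by (auto simp: edge_multiples_def)
  then show "t \<in> edge_power n E (Suc k)" using eq A(4) by (force simp: add.commute)
qed

declare edge_power.simps(2) [simp del]

lemma edge_power_1: "edge_power n E 1 = edge_multiples n E"
proof -
  have "t - expo A 1 \<in> exponents n" if "t \<in> exponents n" "A \<subseteq> keys t" for t A
    using expo_add_diff[OF that(2)] that(1) by (metis exponents_add_iff)
  then show ?thesis
    using edge_power_Suc_iff[of _ n E 0] unfolding edge_multiples_def One_nat_def edge_power.simps(1)
    by blast
qed

lemma edge_power_add:
  "s \<in> edge_power n E k \<Longrightarrow> t \<in> edge_power n E l \<Longrightarrow> s + t \<in> edge_power n E (k + l)"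
proof (induction l arbitrary: t)
  case 0
  then show ?case using edge_power_up by simp
next
  case (Suc l)
  then obtain a b where "t = a + b" "a \<in> edge_power n E l" "b \<in> edge_multiples n E"
    by (auto simp: edge_power.simps)
  with Suc show ?case
    by (auto simp: edge_power.simps add.assoc[symmetric] intro!: exI)
qed

lemma edge_power_split:
  "t \<in> edge_power n E (k + l) \<Longrightarrow> \<exists>a \<in> edge_power n E k. \<exists>b \<in> edge_power n E l. t = a + b"
proof (induction l arbitrary: t)
  case 0
  have "t = t + 0" "0 \<in> edge_power n E 0" by simp_all
  then show ?case using 0 by (metis add_0_right)
next
  case (Suc l)
  then obtain c d where c: "t = c + d" "c \<in> edge_power n E (k + l)" "d \<in> edge_multiples n E"
    by (auto simp: edge_power.simps)
  with Suc.IH obtain a b where "a \<in> edge_power n E k" "b \<in> edge_power n E l" "c = a + b" by blast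
  moreover from this c have "b + d \<in> edge_power n E (Suc l)" by (auto simp: edge_power.simps)
  ultimately show ?case using c(1) by (metis add.assoc)
qed

lemma edge_power_mono:
  assumes "E \<subseteq> E'" "n \<le> n'"
  shows "t \<in> edge_power n E k \<Longrightarrow> t \<in> edge_power n' E' k"
proof (induction k arbitrary: t)
  case 0
  then show ?case using exponents_mono[OF assms(2)] by auto
next
  case (Suc k)
  have "t \<in> exponents n'"
    using edge_power_subset[OF Suc.prems] exponents_mono[OF assms(2)] by blast
  then show ?case using Suc assms(1) unfolding edge_power_Suc_iff by blast
qed

text \<open>
  Each of the \<open>k\<close> edges that make up an element of the \<open>k\<close>-th power meets the cover.
\<close>

lemma weight_edge_power:
  assumes "cover n E C"
  shows "t \<in> edge_power n E k \<Longrightarrow> k \<le> weight C t"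
proof (induction k arbitrary: t)
  case (Suc k)
  obtain A where A: "A \<in> E" "A \<subseteq> keys t" "t - expo A 1 \<in> edge_power n E k"
    using Suc.prems(1) unfolding edge_power_Suc_iff by blast
  have fin: "finite C" "finite A"
    using assms A(2) by (auto simp: cover_def intro: finite_subset)
  have "C \<inter> A \<noteq> {}" using assms A(1) by (auto simp: cover_def)
  then have "1 \<le> card (C \<inter> A)" using fin by (simp add: Suc_le_eq card_gt_0_iff)
  moreover have "weight C t = card (C \<inter> A) + weight C (t - expo A 1)"
    using weight_add[of C "expo A 1" "t - expo A 1"] expo_add_diff[OF A(2)] weight_expo[OF fin, of 1]
    by simp
  ultimately show ?case using Suc.IH[OF A(3)] by simp
qed simp

text \<open>
  The generators of the \<open>k\<close>-th power have exponents at most \<open>k\<close>, since those of the ideal are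
  square-free. Hence the part of an exponent above \<open>k\<close> has no influence on membership.
\<close>

lemma edge_power_truncate:
  "t \<in> edge_power n E k \<Longrightarrow> t' \<in> exponents n \<Longrightarrow>
    (\<And>i. min (lookup t i) k \<le> lookup t' i) \<Longrightarrow> t' \<in> edge_power n E k"
proof (induction k arbitrary: t t')
  case (Suc k)
  obtain A where A: "A \<in> E" "A \<subseteq> keys t" "t - expo A 1 \<in> edge_power n E k"
    using Suc.prems(1) unfolding edge_power_Suc_iff by blast
  have fin: "finite A" using A(2) by (auto intro: finite_subset)
  have keys: "A \<subseteq> keys t'"
  proof
    fix i assume "i \<in> A"
    then have "0 < lookup t i" using A(2) by (auto simp: in_keys_iff)
    then show "i \<in> keys t'" using Suc.prems(3)[of i] by (auto simp: in_keys_iff)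
  qed
  have "t' - expo A 1 \<in> exponents n"
    using expo_add_diff[OF keys] Suc.prems(2) by (metis exponents_add_iff)
  moreover have "min (lookup (t - expo A 1) i) k \<le> lookup (t' - expo A 1) i" for i
    using Suc.prems(3)[of i] by (auto simp: lookup_minus lookup_expo[OF fin])
  ultimately have "t' - expo A 1 \<in> edge_power n E k" using Suc.IH[OF A(3)] by blast
  then show ?case using A(1) keys Suc.prems(2) unfolding edge_power_Suc_iff by blast
qed simp

text \<open>
  Each unit of degree in \<open>A\<close> pays for one edge, the one belonging to its variable, and the \<open>k\<close> edges
  chosen in this way use each variable outside \<open>A\<close> at most \<open>k\<close> times.
\<close>

lemma edge_power_of_private_edges:
  assumes "A \<subseteq> {1..n}"
    and "\<And>i. i \<in> A \<Longrightarrow> \<exists>B\<in>E. B \<subseteq> {1..n} \<and> B \<inter> A = {i}"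
  shows "t \<in> exponents n \<Longrightarrow> k \<le> weight A t \<Longrightarrow> (\<And>j. j \<in> {1..n} - A \<Longrightarrow> k \<le> lookup t j) \<Longrightarrow>
    t \<in> edge_power n E k"
proof (induction k arbitrary: t)
  case (Suc k)
  have finA: "finite A" using assms(1) finite_subset by blast
  have "weight A t \<noteq> 0" using Suc.prems(2) by simp
  then obtain i where i: "i \<in> A" "0 < lookup t i" by (auto simp: weight_def finA)
  then obtain B where B: "B \<in> E" "B \<subseteq> {1..n}" "B \<inter> A = {i}" using assms(2) by blast
  have fin: "finite B" using B(2) finite_subset by blast
  have keys: "B \<subseteq> keys t"
  proof
    fix j assume j: "j \<in> B"
    show "j \<in> keys t"
    proof (cases "j \<in> A")
      case True
      then have "j = i" using B(3) j by blast
      then show ?thesis using i by (simp add: in_keys_iff)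
    next
      case False
      then show ?thesis using Suc.prems(3)[of j] B(2) j by (auto simp: in_keys_iff)
    qed
  qed
  have "weight A t = 1 + weight A (t - expo B 1)"
    using weight_add[of A "expo B 1" "t - expo B 1"] expo_add_diff[OF keys]
      weight_expo[OF finA fin, of 1] B(3) by (simp add: Int_commute)
  then have "k \<le> weight A (t - expo B 1)" using Suc.prems(2) by simp
  moreover have "t - expo B 1 \<in> exponents n"
    using expo_add_diff[OF keys] Suc.prems(1) by (metis exponents_add_iff)
  moreover have "k \<le> lookup (t - expo B 1) j" if "j \<in> {1..n} - A" for j
    using Suc.prems(3)[OF that] by (auto simp: lookup_minus lookup_expo[OF fin])
  ultimately have "t - expo B 1 \<in> edge_power n E k" by (intro Suc.IH)
  then show ?case using B(1) keys Suc.prems(1) unfolding edge_power_Suc_iff by blast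
qed simp


section \<open>Adding one edge\<close>

lemma edge_power_insert:
  "t \<in> edge_power n (insert F E) k \<Longrightarrow>
    \<exists>p q v. p + q = k \<and> v \<in> edge_power n E q \<and> t = expo F p + v"
proof (induction k arbitrary: t)
  case 0
  have "t = expo F 0 + t" by (simp add: expo_def)
  then show ?case using 0 by (intro exI[of _ 0] exI[of _ t]) simp
next
  case (Suc k)
  obtain A where A: "A \<in> insert F E" "A \<subseteq> keys t" "t - expo A 1 \<in> edge_power n (insert F E) k"
    using Suc.prems(1) unfolding edge_power_Suc_iff by blast
  from Suc.IH[OF A(3)] obtain p q v
    where v: "p + q = k" "v \<in> edge_power n E q" "t - expo A 1 = expo F p + v" by blast
  have t: "t = expo A 1 + (expo F p + v)" using expo_add_diff[OF A(2)] v(3) by simp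
  show ?case
  proof (cases "A = F")
    case True
    then have "t = expo F (Suc p) + v"
      using t expo_add[of F 1 p] by (simp add: add.assoc)
    then show ?thesis using v by (intro exI[of _ "Suc p"] exI[of _ q] exI[of _ v]) simp
  next
    case False
    have "A \<subseteq> keys (expo A 1)"
      using finite_subset[OF A(2)] by (auto simp: in_keys_iff lookup_expo)
    moreover have "expo A 1 \<in> exponents n"
      using edge_power_subset[OF Suc.prems] expo_add_diff[OF A(2)] by (metis exponents_add_iff)
    ultimately have "expo A 1 \<in> edge_multiples n E"
      using A(1) False by (auto simp: edge_multiples_def)
    then have "v + expo A 1 \<in> edge_power n E (Suc q)" using v(2) by (auto simp: edge_power.simps)
    moreover have "t = expo F p + (v + expo A 1)" using t by (simp add: algebra_simps)
    ultimately show ?thesis using v(1) by (metis add_Suc_right)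
  qed
qed

lemma expo_in_edge_power:
  assumes "F \<subseteq> {1..n}" "F \<in> E"
  shows "expo F p \<in> edge_power n E p"
proof (induction p)
  case 0
  then show ?case by (simp add: expo_def)
next
  case (Suc p)
  have fin: "finite F" using assms(1) finite_subset by blast
  have "expo F 1 + expo F p = expo F (Suc p)" using expo_add[of F 1 p] by simp
  then have "expo F (Suc p) - expo F 1 = expo F p" by (metis add_diff_cancel_left')
  moreover have "F \<subseteq> keys (expo F (Suc p))" by (auto simp: in_keys_iff lookup_expo[OF fin])
  ultimately show ?case
    using Suc assms expo_in_exponents[OF assms(1)] unfolding edge_power_Suc_iff by metis
qed

text \<open>
  The demotion identity on exponent vectors. The case \<open>q < s\<close> is where torsion-freeness of \<open>E\<close>
  enters: the cofactor of \<open>F\<^sup>r\<close> is recognised as an element of the \<open>s\<close>-th power by its degrees on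
  the covers alone.
\<close>

lemma edge_power_insert_Int:
  assumes tf: "torsion_free n E" and F: "F \<subseteq> {1..n}"
    and t: "t \<in> edge_power n (insert F E) (r + s)" "t \<in> edge_power n E s"
  shows "\<exists>a \<in> edge_power n (insert F E) r. \<exists>b \<in> edge_power n E s. t = a + b"
proof -
  have finF: "finite F" using F finite_subset by blast
  obtain p q v where v: "p + q = r + s" "v \<in> edge_power n E q" "t = expo F p + v"
    using edge_power_insert[OF t(1)] by blast
  show ?thesis
  proof (cases "s \<le> q")
    case True
    then have "v \<in> edge_power n E ((q - s) + s)" using v(2) by simp
    then obtain a b where ab: "a \<in> edge_power n E (q - s)" "b \<in> edge_power n E s" "v = a + b"
      using edge_power_split by blast
    have "a \<in> edge_power n (insert F E) (q - s)"
      using ab(1) edge_power_mono[of E "insert F E" n n] by blast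
    then have "expo F p + a \<in> edge_power n (insert F E) (p + (q - s))"
      using edge_power_add expo_in_edge_power[OF F] by blast
    moreover have "p + (q - s) = r" using v(1) True by simp
    moreover have "t = (expo F p + a) + b" using v(3) ab(3) by (simp add: add.assoc)
    ultimately show ?thesis using ab(2) by metis
  next
    case False
    \<comment> \<open>Here \<open>p > r\<close>, so \<open>r\<close> of the \<open>p\<close> copies of \<open>F\<close> can be split off.\<close>
    define b where "b = expo F (p - r) + v"
    have t_eq: "t = expo F r + b"
      using v False expo_add[of F r "p - r"] by (simp add: b_def add.assoc)
    have "s \<le> weight C b" if C: "cover n E C" for C
    proof (cases "C \<inter> F = {}")
      case True
      have "weight C t = weight C b"
        using True finite_subset[of C "{1..n}"] C finF
        by (simp add: t_eq weight_add weight_expo cover_def)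
      then show ?thesis using weight_edge_power[OF C t(2)] by simp
    next
      case nonempty: False
      have finC: "finite C" using C by (auto simp: cover_def intro: finite_subset)
      have "1 \<le> card (C \<inter> F)" using nonempty finC by (simp add: Suc_le_eq card_gt_0_iff)
      then have "(p - r) * 1 \<le> (p - r) * card (C \<inter> F)" by (rule mult_le_mono2)
      moreover have "weight C b = (p - r) * card (C \<inter> F) + weight C v"
        by (simp add: b_def weight_add weight_expo[OF finC finF])
      ultimately have "(p - r) + q \<le> weight C b"
        using weight_edge_power[OF C v(2)] by linarith
      then show ?thesis using v(1) False by simp
    qed
    moreover have "b \<in> exponents n"
      using edge_power_subset[OF t(1)] t_eq by simp
    ultimately have "b \<in> edge_power n E s" using tf by (simp add: torsion_free_def)
    then show ?thesis using t_eq expo_in_edge_power[OF F, of "insert F E" r] by blast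
  qed
qed

text \<open>
  The inclusion of \<open>h\<^sup>k I\<^sup>k\<close> in \<open>L\<^sup>k\<close>: a copy of \<open>F\<close> absorbs one copy of \<open>H\<close>, whereas an edge of \<open>E\<close>
  leaves its copy of \<open>H\<close> as a surplus factor.
\<close>

lemma expo_add_in_edge_power:
  assumes "H \<subseteq> {Suc n..n + m}"
  shows "t \<in> edge_power n (insert F E) k \<Longrightarrow>
    t + expo H k \<in> edge_power (n + m) (insert (F \<union> H) E) k"
proof (induction k arbitrary: t)
  case 0
  then show ?case using exponents_mono[of n "n + m"] by (auto simp: expo_def)
next
  case (Suc k)
  obtain A where A: "A \<in> insert F E" "A \<subseteq> keys t" "t - expo A 1 \<in> edge_power n (insert F E) k"
    using Suc.prems(1) unfolding edge_power_Suc_iff by blast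
  have finH: "finite H" and finA: "finite A" using assms A(2) by (auto intro: finite_subset)
  have tn: "t \<in> exponents n" using Suc.prems edge_power_subset by blast
  have An: "A \<subseteq> {1..n}" using A(2) tn by (auto simp: exponents_def)
  have disj: "A \<inter> H = {}" using An assms by fastforce
  have HN: "H \<subseteq> {1..n + m}" using assms by auto
  have in_exps: "t + expo H (Suc k) \<in> exponents (n + m)"
    using tn expo_in_exponents[OF HN] exponents_mono[of n "n + m"] by auto
  have H: "expo H (Suc k) = expo H k + expo H 1" using expo_add[of H k 1] by simp
  have IH: "(t - expo A 1) + expo H k \<in> edge_power (n + m) (insert (F \<union> H) E) k"
    using Suc.IH[OF A(3)] .
  show ?case
  proof (cases "A = F")
    case True
    have "expo (F \<union> H) 1 = expo A 1 + expo H 1"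
      using disj True finH finA by (simp add: expo_def sum.union_disjoint)
    moreover have "expo A 1 + expo H 1 + ((t - expo A 1) + expo H k) = t + expo H (Suc k)"
      using expo_add_diff[OF A(2)] H by (metis (no_types, lifting) add.assoc add.commute)
    ultimately have "t + expo H (Suc k) - expo (F \<union> H) 1 = (t - expo A 1) + expo H k"
      by (metis add_diff_cancel_left')
    moreover have "F \<union> H \<subseteq> keys (t + expo H (Suc k))"
      using A(2) True by (auto simp: keys_add_nat in_keys_iff lookup_expo[OF finH])
    ultimately show ?thesis using IH in_exps unfolding edge_power_Suc_iff by auto
  next
    case False
    have "expo A 1 + ((t - expo A 1) + expo H k + expo H 1) = t + expo H (Suc k)"
      using expo_add_diff[OF A(2)] H by (metis (no_types, lifting) add.assoc add.commute)
    then have "t + expo H (Suc k) - expo A 1 = (t - expo A 1) + expo H k + expo H 1"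
      by (metis add_diff_cancel_left')
    moreover have "(t - expo A 1) + expo H k + expo H 1
        \<in> edge_power (n + m) (insert (F \<union> H) E) k"
      using IH edge_power_up expo_in_exponents[OF HN] by blast
    moreover have "A \<subseteq> keys (t + expo H (Suc k))" using A(2) by (auto simp: keys_add_nat)
    ultimately show ?thesis using in_exps A(1) False unfolding edge_power_Suc_iff by auto
  qed
qed

text \<open>
  The covers of the enlarged hypergraph include those of \<open>insert F E\<close> and those of \<open>E\<close> with one
  new vertex added; the two kinds give membership in a power for \<open>insert F E\<close> and in one for \<open>E\<close>,
  which the demotion identity combines.
\<close>

lemma torsion_free_enlarge_edge:
  fixes n m :: nat
  assumes E: "torsion_free n E" and FE: "torsion_free n (insert F E)"
    and F: "F \<subseteq> {1..n}"
  defines "H \<equiv> {Suc n..n + m}"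
  shows "torsion_free (n + m) (insert (F \<union> H) E)"
  unfolding torsion_free_def
proof (intro allI ballI impI)
  fix k t
  assume t: "t \<in> exponents (n + m)"
    and wt: "\<forall>C. cover (n + m) (insert (F \<union> H) E) C \<longrightarrow> k \<le> weight C t"
  define u where "u = (\<Sum>i\<in>{1..n}. Poly_Mapping.single i (lookup t i))"
  have lookup_u: "lookup u i = (if i \<in> {1..n} then lookup t i else 0)" for i
    by (simp add: u_def lookup_sum lookup_single when_def sum.delta)
  have u: "u \<in> exponents n"
    by (auto simp: exponents_def in_keys_iff lookup_u split: if_splits)
  have wu: "weight C t = weight C u" if "C \<subseteq> {1..n}" for C
    unfolding weight_def using that by (intro sum.cong) (auto simp: lookup_u)
  \<comment> \<open>Including \<open>k\<close> bounds \<open>e\<close> by \<open>k\<close> and gives \<open>H = {}\<close> the value \<open>e = k\<close>, so that no case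
    distinction on \<open>m\<close> is needed.\<close>
  define e where "e = Min (insert k (lookup t ` H))"
  have fin: "finite (insert k (lookup t ` H))" by (simp add: H_def)
  have finH: "finite H" by (simp add: H_def)
  have ek: "e \<le> k" unfolding e_def by (rule Min_le) (use fin in auto)
  have eH: "e \<le> lookup t i" if "i \<in> H" for i
    unfolding e_def by (rule Min_le) (use fin that in auto)
  have "e \<in> insert k (lookup t ` H)" unfolding e_def by (rule Min_in) (use fin in auto)
  then have e_cases: "e = k \<or> (\<exists>i\<in>H. e = lookup t i)" by blast
  have "u \<in> edge_power n (insert F E) k"
  proof -
    have "k \<le> weight C u" if C: "cover n (insert F E) C" for C
    proof -
      have "cover (n + m) (insert (F \<union> H) E) C" using C by (auto simp: cover_def)
      then have "k \<le> weight C t" using wt by blast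
      also have "\<dots> = weight C u" using C by (intro wu) (simp add: cover_def)
      finally show ?thesis .
    qed
    then show ?thesis using FE u by (simp add: torsion_free_def)
  qed
  moreover have "u \<in> edge_power n E (k - e)"
  proof -
    have "k - e \<le> weight C u" if C: "cover n E C" for C
    proof (cases "e = k")
      case False
      then obtain i where i: "i \<in> H" "e = lookup t i" using e_cases by blast
      have "cover (n + m) (insert (F \<union> H) E) (insert i C)"
        using C i(1) by (auto simp: cover_def H_def)
      then have "k \<le> weight (insert i C) t" using wt by blast
      also have "i \<notin> C" "finite C"
        using C i(1) by (auto simp: cover_def H_def intro: finite_subset)
      then have "weight (insert i C) t = e + weight C u"
        using i wu[of C] C by (simp add: weight_def cover_def)
      finally show ?thesis by simp
    qed simp
    then show ?thesis using E u by (simp add: torsion_free_def)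
  qed
  ultimately obtain a b
    where ab: "a \<in> edge_power n (insert F E) e" "b \<in> edge_power n E (k - e)" "u = a + b"
    using edge_power_insert_Int[OF E F, of u e "k - e"] ek by auto
  have "a + expo H e \<in> edge_power (n + m) (insert (F \<union> H) E) e"
    using expo_add_in_edge_power[of H n m] ab(1) by (simp add: H_def)
  moreover have "b \<in> edge_power (n + m) (insert (F \<union> H) E) (k - e)"
    using edge_power_mono[OF _ _ ab(2), of "insert (F \<union> H) E" "n + m"] by auto
  ultimately have "(a + expo H e) + b \<in> edge_power (n + m) (insert (F \<union> H) E) k"
    using edge_power_add[of _ _ _ e _ "k - e"] ek by fastforce
  then have uH: "u + expo H e \<in> edge_power (n + m) (insert (F \<union> H) E) k"
    using ab(3) by (simp add: algebra_simps)
  have "lookup (u + expo H e) i \<le> lookup t i" for i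
    using eH[of i] by (cases "i \<in> H") (auto simp: lookup_add lookup_u lookup_expo[OF finH], simp add: H_def)
  then have eq: "(u + expo H e) + (t - (u + expo H e)) = t" by (rule add_diff_exponent)
  then have "t - (u + expo H e) \<in> exponents (n + m)" using t by (metis exponents_add_iff)
  then show "t \<in> edge_power (n + m) (insert (F \<union> H) E) k"
    using edge_power_up[OF uH] eq by metis
qed

section \<open>Monomial ideals as sets of exponent vectors\<close>

text \<open>
  The monomial ideals are the sets \<open>mspan T\<close> with \<open>T\<close> closed under multiplication by monomials, so
  that arithmetic of monomial ideals becomes arithmetic of such sets \<open>T\<close>.
\<close>

definition mspan :: "(nat \<Rightarrow>\<^sub>0 nat) set \<Rightarrow> 'k::comm_ring_1 mpoly set" where
  "mspan T = {p. keys p \<subseteq> T}"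

definition upclosed :: "nat \<Rightarrow> (nat \<Rightarrow>\<^sub>0 nat) set \<Rightarrow> bool" where
  "upclosed n T \<longleftrightarrow> T \<subseteq> exponents n \<and> (\<forall>t\<in>T. \<forall>s\<in>exponents n. t + s \<in> T)"

lemma carrier_mpoly_ring: "carrier (mpoly_ring n) = mspan (exponents n)"
  by (auto simp: mpoly_ring_def mspan_def exponents_def)

lemma mpoly_ring_ops [simp]:
  "x \<otimes>\<^bsub>mpoly_ring n\<^esub> y = x * y" "x \<oplus>\<^bsub>mpoly_ring n\<^esub> y = x + y"
  "\<one>\<^bsub>mpoly_ring n\<^esub> = 1" "\<zero>\<^bsub>mpoly_ring n\<^esub> = 0"
  by (simp_all add: mpoly_ring_def)

lemma mspan_mono: "S \<subseteq> T \<Longrightarrow> mspan S \<subseteq> mspan T"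
  by (auto simp: mspan_def)

lemma mspan_Int: "mspan (S \<inter> T) = mspan S \<inter> mspan T"
  by (auto simp: mspan_def)

lemma mspan_add: "p \<in> mspan T \<Longrightarrow> q \<in> mspan T \<Longrightarrow> p + q \<in> mspan T"
  using Poly_Mapping.keys_add[of p q] by (auto simp: mspan_def)

lemma mspan_mult:
  assumes "p \<in> mspan S" "q \<in> mspan T" "\<And>s t. s \<in> S \<Longrightarrow> t \<in> T \<Longrightarrow> s + t \<in> U"
  shows "p * q \<in> mspan U"
  using keys_mult[of p q] assms by (fastforce simp: mspan_def)

lemma single_in_mspan: "t \<in> T \<Longrightarrow> Poly_Mapping.single t c \<in> mspan T"
  by (simp add: mspan_def)

lemma sum_of_terms: "(\<Sum>t\<in>keys p. Poly_Mapping.single t (lookup p t)) = p"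
  by (rule poly_mapping_eqI)
    (auto simp: lookup_sum lookup_single when_def sum.delta in_keys_iff)

lemma ideal_mspan:
  assumes "upclosed n T"
  shows "ideal (mspan T) (mpoly_ring n :: 'k::comm_ring_1 mpoly ring)"
proof -
  interpret R: cring "mpoly_ring n :: 'k mpoly ring" by (rule cring_mpoly_ring)
  have sub: "mspan T \<subseteq> (carrier (mpoly_ring n) :: 'k mpoly set)"
    unfolding carrier_mpoly_ring using assms by (intro mspan_mono) (simp add: upclosed_def)
  have neg: "\<ominus>\<^bsub>mpoly_ring n\<^esub> p = - p" if p: "p \<in> carrier (mpoly_ring n)" for p :: "'k mpoly"
    using p by (intro R.minus_equality) (simp_all add: carrier_mpoly_ring mspan_def)
  have closed: "p * q \<in> mspan T" if "p \<in> mspan T" "q \<in> carrier (mpoly_ring n)" for p q :: "'k mpoly"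
    using that assms by (auto simp: upclosed_def carrier_mpoly_ring intro!: mspan_mult)
  show ?thesis
  proof (rule idealI)
    show "subgroup (mspan T) (add_monoid (mpoly_ring n :: 'k mpoly ring))"
    proof (rule R.add.subgroupI)
      show "mspan T \<noteq> ({} :: 'k mpoly set)" by (auto simp: mspan_def intro!: exI[of _ 0])
      show "\<ominus>\<^bsub>mpoly_ring n\<^esub> p \<in> mspan T" if "p \<in> mspan T" for p :: "'k mpoly"
      proof -
        have "\<ominus>\<^bsub>mpoly_ring n\<^esub> p = - p" using that sub neg by blast
        then show ?thesis using that by (simp add: mspan_def)
      qed
    qed (use sub in \<open>auto simp: mspan_add\<close>)
  qed (use closed R.ring_axioms in \<open>auto simp: mult.commute\<close>)
qed

lemma ideal_sum_closed:
  assumes K: "ideal K (mpoly_ring n :: 'k::comm_ring_1 mpoly ring)"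
    and "finite A" "\<And>a. a \<in> A \<Longrightarrow> f a \<in> K"
  shows "(\<Sum>a\<in>A. f a) \<in> K"
  using assms(2,3)
proof (induction rule: finite_induct)
  case empty
  then show ?case using additive_subgroup.zero_closed[OF ideal.axioms(1)[OF K]] by simp
next
  case (insert a A)
  then show ?case
    using additive_subgroup.a_closed[OF ideal.axioms(1)[OF K], of "f a" "\<Sum>a\<in>A. f a"] by simp
qed

text \<open>
  The one tool for showing that a monomial ideal is contained in a given ideal: it suffices to
  look at monomials with coefficient one.
\<close>

lemma mspan_least:
  assumes K: "ideal K (mpoly_ring n :: 'k::comm_ring_1 mpoly ring)" and "T \<subseteq> exponents n"
    and T: "\<And>t. t \<in> T \<Longrightarrow> Poly_Mapping.single t 1 \<in> K"
  shows "mspan T \<subseteq> K"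
proof
  fix p :: "'k mpoly"
  assume p: "p \<in> mspan T"
  have "Poly_Mapping.single t (lookup p t) \<in> K" if "t \<in> keys p" for t
  proof -
    have "Poly_Mapping.single 0 (lookup p t) \<in> carrier (mpoly_ring n)"
      by (simp add: carrier_mpoly_ring mspan_def)
    moreover have "Poly_Mapping.single t 1 \<in> K" using that p T by (auto simp: mspan_def)
    ultimately have "Poly_Mapping.single 0 (lookup p t) \<otimes>\<^bsub>mpoly_ring n\<^esub> Poly_Mapping.single t 1 \<in> K"
      by (intro ideal.I_l_closed[OF K])
    then show ?thesis by (simp add: mult_single)
  qed
  then have "(\<Sum>t\<in>keys p. Poly_Mapping.single t (lookup p t)) \<in> K"
    by (intro ideal_sum_closed[OF K]) auto
  then show "p \<in> K" by (simp add: sum_of_terms)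
qed

lemma ideal_prod_mspan:
  assumes "upclosed n S" "upclosed n T"
  shows "mspan S \<cdot>\<^bsub>mpoly_ring n\<^esub> mspan T
    = (mspan {s + t | s t. s \<in> S \<and> t \<in> T} :: 'k::comm_ring_1 mpoly set)"
proof
  interpret R: cring "mpoly_ring n :: 'k mpoly ring" by (rule cring_mpoly_ring)
  let ?U = "{s + t | s t. s \<in> S \<and> t \<in> T}"
  show "mspan S \<cdot>\<^bsub>mpoly_ring n\<^esub> mspan T \<subseteq> (mspan ?U :: 'k mpoly set)"
  proof
    fix p :: "'k mpoly"
    assume "p \<in> mspan S \<cdot>\<^bsub>mpoly_ring n\<^esub> mspan T"
    then show "p \<in> mspan ?U"
      by (induction rule: ideal_prod.induct) (auto intro: mspan_mult mspan_add)
  qed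
  show "mspan ?U \<subseteq> (mspan S \<cdot>\<^bsub>mpoly_ring n\<^esub> mspan T :: 'k mpoly set)"
  proof (rule mspan_least)
    show "ideal (mspan S \<cdot>\<^bsub>mpoly_ring n\<^esub> mspan T) (mpoly_ring n :: 'k mpoly ring)"
      by (intro R.ideal_prod_is_ideal ideal_mspan assms)
    show "?U \<subseteq> exponents n" using assms by (auto simp: upclosed_def)
    show "Poly_Mapping.single u 1 \<in> (mspan S \<cdot>\<^bsub>mpoly_ring n\<^esub> mspan T :: 'k mpoly set)" if u: "u \<in> ?U" for u
    proof -
      obtain s t where st: "u = s + t" "s \<in> S" "t \<in> T" using u by blast
      have "Poly_Mapping.single s 1 \<otimes>\<^bsub>mpoly_ring n\<^esub> Poly_Mapping.single t (1::'k)
          \<in> mspan S \<cdot>\<^bsub>mpoly_ring n\<^esub> mspan T"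
        using st by (intro ideal_prod.prod single_in_mspan)
      then show ?thesis using st(1) by (simp add: mult_single)
    qed
  qed
qed

lemma upclosed_edge_power: "upclosed n (edge_power n E k)"
  by (auto simp: upclosed_def edge_power_subset edge_power_up)

lemma upclosed_edge_multiples: "upclosed n (edge_multiples n E)"
  using upclosed_edge_power[of n E 1] by (simp only: edge_power_1)

lemma ideal_power_mspan:
  "ideal_power (mpoly_ring n) (mspan (edge_multiples n E) :: 'k::comm_ring_1 mpoly set) k
    = mspan (edge_power n E k)"
proof (induction k)
  case 0
  then show ?case unfolding ideal_power_0 carrier_mpoly_ring by simp
next
  case (Suc k)
  then show ?case
    unfolding ideal_power_Suc
    by (simp add: ideal_prod_mspan upclosed_edge_power upclosed_edge_multiples edge_power.simps)
qed

lemma prod_var: "(\<Prod>i\<in>A. var i) = (Poly_Mapping.single (expo A 1) 1 :: 'k::comm_ring_1 mpoly)"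
  by (induction A rule: infinite_finite_induct) (simp_all add: expo_def var_def mult_single)

lemma expo_in_edge_multiples: "A \<in> E \<Longrightarrow> A \<subseteq> {1..n} \<Longrightarrow> expo A 1 \<in> edge_multiples n E"
  using expo_in_edge_power[of A n E 1] by (simp only: edge_power_1)

lemma genideal_eq_mspan:
  assumes "E \<subseteq> Pow {1..n}"
  shows "Idl\<^bsub>mpoly_ring n\<^esub> ((\<lambda>A. \<Prod>i\<in>A. var i) ` E)
    = (mspan (edge_multiples n E) :: 'k::comm_ring_1 mpoly set)" (is "Idl\<^bsub>_\<^esub> ?G = _")
proof
  interpret R: cring "mpoly_ring n :: 'k mpoly ring" by (rule cring_mpoly_ring)
  have sub: "?G \<subseteq> mspan (edge_multiples n E)"
    using assms by (auto simp only: prod_var image_subset_iff Pow_iff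
        intro!: single_in_mspan expo_in_edge_multiples)
  show "Idl\<^bsub>mpoly_ring n\<^esub> ?G \<subseteq> mspan (edge_multiples n E)"
    by (intro R.genideal_minimal ideal_mspan upclosed_edge_multiples sub)
  have "?G \<subseteq> carrier (mpoly_ring n)"
    using sub mspan_mono[of "edge_multiples n E" "exponents n"]
    unfolding carrier_mpoly_ring by (auto simp: edge_multiples_def)
  then have K: "ideal (Idl\<^bsub>mpoly_ring n\<^esub> ?G) (mpoly_ring n)" and G: "?G \<subseteq> Idl\<^bsub>mpoly_ring n\<^esub> ?G"
    by (rule R.genideal_ideal, rule R.genideal_self)
  show "mspan (edge_multiples n E) \<subseteq> Idl\<^bsub>mpoly_ring n\<^esub> ?G"
  proof (rule mspan_least[OF K])
    fix t assume "t \<in> edge_multiples n E"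
    then obtain A where A: "t \<in> exponents n" "A \<in> E" "A \<subseteq> keys t"
      by (auto simp: edge_multiples_def)
    have eq: "expo A 1 + (t - expo A 1) = t" using A(3) by (rule expo_add_diff)
    then have "t - expo A 1 \<in> exponents n" using A(1) by (metis exponents_add_iff)
    then have "Poly_Mapping.single (t - expo A 1) 1 \<in> (carrier (mpoly_ring n) :: 'k mpoly set)"
      unfolding carrier_mpoly_ring by (rule single_in_mspan)
    moreover have "(\<Prod>i\<in>A. var i) \<in> Idl\<^bsub>mpoly_ring n\<^esub> ?G" using G A(2) by blast
    ultimately have "(\<Prod>i\<in>A. var i) \<otimes>\<^bsub>mpoly_ring n\<^esub> Poly_Mapping.single (t - expo A 1) (1::'k)
        \<in> Idl\<^bsub>mpoly_ring n\<^esub> ?G"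
      by (intro ideal.I_r_closed[OF K])
    then show "Poly_Mapping.single t (1::'k) \<in> Idl\<^bsub>mpoly_ring n\<^esub> ?G"
      by (simp add: prod_var mult_single eq del: One_nat_def)
  qed (auto simp: edge_multiples_def)
qed

lemma squarefree_monomial_ideal_iff:
  "squarefree_monomial_ideal n (I :: 'k::comm_ring_1 mpoly set) \<longleftrightarrow>
    (\<exists>E \<subseteq> Pow {1..n}. I = mspan (edge_multiples n E))"
proof -
  have "(squarefree_monomials n :: 'k mpoly set) = (\<lambda>A. \<Prod>i\<in>A. var i) ` Pow {1..n}"
    by (auto simp: squarefree_monomials_def)
  then have "squarefree_monomial_ideal n I \<longleftrightarrow>
      (\<exists>E \<subseteq> Pow {1..n}. I = Idl\<^bsub>mpoly_ring n\<^esub> ((\<lambda>A. \<Prod>i\<in>A. var i) ` E))"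
    unfolding squarefree_monomial_ideal_def by (simp only: subset_image_iff) blast
  then show ?thesis by (metis genideal_eq_mspan)
qed

lemma add_principal_eq_mspan:
  assumes E: "E \<subseteq> Pow {1..n}" and F: "F \<subseteq> {1..n}"
  shows "mspan (edge_multiples n E) <+>\<^bsub>mpoly_ring n\<^esub> PIdl\<^bsub>mpoly_ring n\<^esub> (\<Prod>i\<in>F. var i)
    = (mspan (edge_multiples n (insert F E)) :: 'k::comm_ring_1 mpoly set)"
proof -
  interpret R: cring "mpoly_ring n :: 'k mpoly ring" by (rule cring_mpoly_ring)
  let ?f = "\<lambda>A. \<Prod>i\<in>A. var i :: 'k mpoly"
  have f: "?f F \<in> carrier (mpoly_ring n)"
    unfolding carrier_mpoly_ring prod_var by (intro single_in_mspan expo_in_exponents F)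
  have F': "PIdl\<^bsub>mpoly_ring n\<^esub> (?f F) = mspan (edge_multiples n {F})"
    using R.cgenideal_eq_genideal[OF f] genideal_eq_mspan[of "{F}" n] F by simp
  have un: "edge_multiples n (insert F E) = edge_multiples n E \<union> edge_multiples n {F}"
    by (auto simp: edge_multiples_def)
  have id: "ideal (mspan (edge_multiples n D)) (mpoly_ring n :: 'k mpoly ring)" for D
    by (intro ideal_mspan upclosed_edge_multiples)
  let ?S = "mspan (edge_multiples n E) <+>\<^bsub>mpoly_ring n\<^esub> mspan (edge_multiples n {F}) :: 'k mpoly set"
  have S: "?S = {a + b | a b. a \<in> mspan (edge_multiples n E) \<and> b \<in> mspan (edge_multiples n {F})}"
    by (auto simp: set_add_def')
  have zero: "0 \<in> (mspan T :: 'k mpoly set)" for T by (simp add: mspan_def)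
  show ?thesis unfolding F'
  proof
    show "?S \<subseteq> mspan (edge_multiples n (insert F E))"
    proof
      fix p assume "p \<in> ?S"
      then obtain a b where ab: "p = a + b" "a \<in> mspan (edge_multiples n E)"
        "b \<in> mspan (edge_multiples n {F})" unfolding S by blast
      have "a \<in> mspan (edge_multiples n (insert F E))" "b \<in> mspan (edge_multiples n (insert F E))"
        using ab by (auto simp: un mspan_def)
      then show "p \<in> mspan (edge_multiples n (insert F E))" unfolding ab(1) by (rule mspan_add)
    qed
    show "mspan (edge_multiples n (insert F E)) \<subseteq> ?S"
    proof (rule mspan_least[OF R.add_ideals[OF id id]])
      fix t assume "t \<in> edge_multiples n (insert F E)"
      then have "t \<in> edge_multiples n E \<or> t \<in> edge_multiples n {F}" by (auto simp: un)
      then show "Poly_Mapping.single t 1 \<in> ?S"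
      proof
        assume "t \<in> edge_multiples n E"
        then show ?thesis unfolding S
          by (intro CollectI exI[of _ "Poly_Mapping.single t 1"] exI[of _ 0])
            (simp add: single_in_mspan zero)
      next
        assume "t \<in> edge_multiples n {F}"
        then show ?thesis unfolding S
          by (intro CollectI exI[of _ "Poly_Mapping.single t 1"] exI[of _ 0])
            (simp add: single_in_mspan zero)
      qed
    qed (auto simp: edge_multiples_def)
  qed
qed

lemma genideal_extend:
  assumes E: "E \<subseteq> Pow {1..n}" and "n \<le> N"
  shows "Idl\<^bsub>mpoly_ring N\<^esub> (mspan (edge_multiples n E))
    = (mspan (edge_multiples N E) :: 'k::comm_ring_1 mpoly set)"
proof
  interpret R: cring "mpoly_ring N :: 'k mpoly ring" by (rule cring_mpoly_ring)
  have sub: "mspan (edge_multiples n E) \<subseteq> (mspan (edge_multiples N E) :: 'k mpoly set)"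
    using exponents_mono[OF assms(2)] by (intro mspan_mono) (auto simp: edge_multiples_def)
  then show "Idl\<^bsub>mpoly_ring N\<^esub> (mspan (edge_multiples n E)) \<subseteq> (mspan (edge_multiples N E) :: 'k mpoly set)"
    by (intro R.genideal_minimal ideal_mspan upclosed_edge_multiples)
  have "mspan (edge_multiples N E) \<subseteq> (carrier (mpoly_ring N) :: 'k mpoly set)"
    unfolding carrier_mpoly_ring by (intro mspan_mono) (auto simp: edge_multiples_def)
  with sub have car: "mspan (edge_multiples n E) \<subseteq> (carrier (mpoly_ring N) :: 'k mpoly set)" by blast
  let ?G = "(\<lambda>A. \<Prod>i\<in>A. var i :: 'k mpoly) ` E"
  have "?G \<subseteq> mspan (edge_multiples n E)"
    using E by (auto simp only: prod_var image_subset_iff Pow_iff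
        intro!: single_in_mspan expo_in_edge_multiples)
  then have "?G \<subseteq> Idl\<^bsub>mpoly_ring N\<^esub> (mspan (edge_multiples n E))"
    using R.genideal_self[OF car] by blast
  then have "Idl\<^bsub>mpoly_ring N\<^esub> ?G \<subseteq> Idl\<^bsub>mpoly_ring N\<^esub> (mspan (edge_multiples n E))"
    by (intro R.genideal_minimal R.genideal_ideal car)
  moreover have "E \<subseteq> Pow {1..N}" using E assms(2) by fastforce
  ultimately show "mspan (edge_multiples N E) \<subseteq> Idl\<^bsub>mpoly_ring N\<^esub> (mspan (edge_multiples n E) :: 'k mpoly set)"
    by (simp add: genideal_eq_mspan)
qed

section \<open>Monomial primes and their powers\<close>

text \<open>The \<open>k\<close>-th power of the prime generated by the variables in \<open>C\<close>.\<close>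

definition weight_ideal :: "nat \<Rightarrow> nat set \<Rightarrow> nat \<Rightarrow> 'k::comm_ring_1 mpoly set" where
  "weight_ideal n C k = mspan {t \<in> exponents n. k \<le> weight C t}"

lemma ideal_weight_ideal: "ideal (weight_ideal n C k) (mpoly_ring n)"
  unfolding weight_ideal_def by (rule ideal_mspan) (auto simp: upclosed_def weight_add)

lemma weight_ideal_0: "weight_ideal n C 0 = carrier (mpoly_ring n)"
  by (simp add: weight_ideal_def carrier_mpoly_ring)

lemma weight_ideal_mult:
  "p \<in> weight_ideal n C k \<Longrightarrow> q \<in> weight_ideal n C l \<Longrightarrow> p * q \<in> weight_ideal n C (k + l)"
  unfolding weight_ideal_def by (erule (1) mspan_mult) (auto simp: weight_add)

lemma split_by_predicate:
  fixes p :: "'k::comm_ring_1 mpoly"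
  shows "\<exists>a b. p = a + b \<and> keys a = {t \<in> keys p. P t} \<and> keys b = {t \<in> keys p. \<not> P t}"
proof -
  define a where "a = (\<Sum>t\<in>{t \<in> keys p. P t}. Poly_Mapping.single t (lookup p t))"
  have a: "lookup a t = (if P t then lookup p t else 0)" for t
    by (auto simp: a_def lookup_sum lookup_single when_def sum.delta in_keys_iff)
  have "keys a = {t \<in> keys p. P t}" "keys (p - a) = {t \<in> keys p. \<not> P t}"
    by (auto simp: in_keys_iff a lookup_minus split: if_splits)
  then show ?thesis by (intro exI[of _ a] exI[of _ "p - a"]) simp
qed

text \<open>
  The lowest \<open>C\<close>-homogeneous parts of \<open>p\<close> and \<open>q\<close> have a nonzero product, because polynomials over a
  field form a domain, and nothing of higher degree can cancel it.
\<close>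

lemma lowest_weight_of_product:
  fixes p q :: "'k::field mpoly"
  assumes s: "s \<in> keys p" "weight C s = 0" and q: "t \<in> keys q"
  shows "\<exists>u \<in> keys (p * q). weight C u \<le> weight C t"
proof -
  define d where "d = Min (weight C ` keys q)"
  have dq: "d \<le> weight C u" if "u \<in> keys q" for u unfolding d_def using that by simp
  have "d \<in> weight C ` keys q" unfolding d_def using q by (intro Min_in) auto
  then obtain t' where t': "t' \<in> keys q" "weight C t' = d" by auto
  obtain p0 p1 where p: "p = p0 + p1" "keys p0 = {t \<in> keys p. weight C t = 0}"
    "keys p1 = {t \<in> keys p. weight C t \<noteq> 0}"
    using split_by_predicate[of p "\<lambda>t. weight C t = 0"] by blast
  obtain q0 q1 where q': "q = q0 + q1" "keys q0 = {t \<in> keys q. weight C t = d}"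
    "keys q1 = {t \<in> keys q. weight C t \<noteq> d}"
    using split_by_predicate[of q "\<lambda>t. weight C t = d"] by blast
  have "p0 \<noteq> 0" using p(2) s by auto
  moreover have "q0 \<noteq> 0" using q'(2) t' by auto
  ultimately have "p0 * q0 \<noteq> 0" by simp
  then obtain u where u: "u \<in> keys (p0 * q0)" by (metis all_not_in_conv keys_eq_empty)
  then have wu: "weight C u = d" using keys_mult[of p0 q0] p(2) q'(2) by (auto simp: weight_add)
  have q1: "d < weight C b" if "b \<in> keys q1" for b
    using that dq[of b] q'(3) by auto
  have "u \<notin> keys (p0 * q1)"
    using keys_mult[of p0 q1] q1 wu by (fastforce simp: weight_add)
  moreover have "u \<notin> keys (p1 * q)"
    using keys_mult[of p1 q] dq wu p(3) by (fastforce simp: weight_add)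
  moreover have "p * q = p0 * q0 + (p0 * q1 + p1 * q)"
    by (simp add: p(1) q'(1) algebra_simps)
  ultimately have "lookup (p * q) u = lookup (p0 * q0) u"
    by (simp add: lookup_add in_keys_iff)
  then have "u \<in> keys (p * q)" using u by (simp add: in_keys_iff)
  then show ?thesis using wu dq[OF q] by blast
qed

text \<open>
  A polynomial outside the prime has a monomial of \<open>C\<close>-degree zero, so multiplying by it does not
  raise the lowest \<open>C\<close>-degree.
\<close>

lemma weight_ideal_primary:
  fixes p q :: "'k::field mpoly"
  assumes "p \<in> carrier (mpoly_ring n)" "q \<in> carrier (mpoly_ring n)"
    and "p * q \<in> weight_ideal n C k" and "p \<notin> weight_ideal n C 1"
  shows "q \<in> weight_ideal n C k"
proof -
  obtain s where s: "s \<in> keys p" "weight C s = 0"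
    using assms(1,4) by (force simp: weight_ideal_def mspan_def carrier_mpoly_ring)
  have "k \<le> weight C t" if t: "t \<in> keys q" for t
    using lowest_weight_of_product[OF s t] assms(3)
    by (force simp: weight_ideal_def mspan_def)
  then show ?thesis using assms(2) by (auto simp: weight_ideal_def mspan_def carrier_mpoly_ring)
qed

lemma one_notin_weight_ideal: "1 \<notin> (weight_ideal n C 1 :: 'k::field mpoly set)"
  by (simp add: weight_ideal_def mspan_def weight_def)

lemma primeideal_weight_ideal:
  "primeideal (weight_ideal n C 1) (mpoly_ring n :: 'k::field mpoly ring)"
proof (rule primeidealI[OF ideal_weight_ideal cring_mpoly_ring])
  have "1 \<in> (carrier (mpoly_ring n) :: 'k mpoly set)" by (simp add: carrier_mpoly_ring mspan_def)
  then show "carrier (mpoly_ring n) \<noteq> (weight_ideal n C 1 :: 'k mpoly set)"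
    using one_notin_weight_ideal by blast
qed (use weight_ideal_primary[of _ n _ C 1] in auto)


section \<open>Associated primes and torsion-freeness\<close>

lemma associated_primes_quotient_module:
  assumes "cring R" and K: "ideal K R"
  shows "P \<in> associated_primes R (quotient_module R K) \<longleftrightarrow>
    primeideal P R \<and> (\<exists>g \<in> carrier R. P = {r \<in> carrier R. r \<otimes>\<^bsub>R\<^esub> g \<in> K})"
proof -
  interpret R: cring R by fact
  interpret K: ideal K R by fact
  have car: "carrier (quotient_module R K) = (\<lambda>g. K +>\<^bsub>R\<^esub> g) ` carrier R"
    by (auto simp: quotient_module_def FactRing_def A_RCOSETS_def')
  have zero: "\<zero>\<^bsub>quotient_module R K\<^esub> = K" by (simp add: quotient_module_def FactRing_def)
  have smult: "r \<odot>\<^bsub>quotient_module R K\<^esub> (K +>\<^bsub>R\<^esub> g) = K +>\<^bsub>R\<^esub> (r \<otimes>\<^bsub>R\<^esub> g)"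
    if "r \<in> carrier R" "g \<in> carrier R" for r g
    using K.rcoset_mult_add[OF that] by (simp add: quotient_module_def FactRing_def)
  have "K +>\<^bsub>R\<^esub> x = K \<longleftrightarrow> x \<in> K" if "x \<in> carrier R" for x
    using K.rcos_const_imp_mem[OF that] R.a_rcos_zero[OF K] by blast
  then have "{r \<in> carrier R. r \<odot>\<^bsub>quotient_module R K\<^esub> (K +>\<^bsub>R\<^esub> g) = \<zero>\<^bsub>quotient_module R K\<^esub>}
      = {r \<in> carrier R. r \<otimes>\<^bsub>R\<^esub> g \<in> K}" if "g \<in> carrier R" for g
    by (intro Collect_cong conj_cong refl) (simp add: that smult zero)
  then show ?thesis unfolding associated_primes_def car by auto
qed

lemma mult_single_in_mspan_iff:
  fixes r :: "'k::field mpoly"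
  shows "r * Poly_Mapping.single v 1 \<in> mspan T \<longleftrightarrow> (\<forall>t\<in>keys r. t + v \<in> T)"
proof
  assume "r * Poly_Mapping.single v 1 \<in> mspan T"
  moreover have "lookup (r * Poly_Mapping.single v 1) (t + v) = lookup r t" for t
  proof -
    have "r * Poly_Mapping.single v 1 = (\<Sum>t\<in>keys r. Poly_Mapping.single (t + v) (lookup r t))"
      by (subst sum_of_terms[of r, symmetric], subst sum_distrib_right) (simp add: mult_single)
    then show ?thesis
      by (auto simp: lookup_sum lookup_single when_def sum.delta in_keys_iff)
  qed
  ultimately show "\<forall>t\<in>keys r. t + v \<in> T" by (auto simp: mspan_def in_keys_iff)
next
  assume "\<forall>t\<in>keys r. t + v \<in> T"
  then show "r * Poly_Mapping.single v 1 \<in> mspan T"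
    by (intro mspan_mult[of r "keys r" _ "{v}"]) (auto simp: mspan_def)
qed

text \<open>
  Membership in the colon of a monomial ideal by a single monomial \<open>v\<close> is decided term by term, so a
  condition on monomials is enough to recognise the colon as a prime generated by variables. All
  associated primes constructed below arise in this way.
\<close>

lemma weight_ideal_associated_prime:
  assumes T: "upclosed n T" and v: "v \<in> exponents n"
    and colon: "\<And>t. t \<in> exponents n \<Longrightarrow> t + v \<in> T \<longleftrightarrow> 1 \<le> weight C t"
  shows "weight_ideal n C 1 \<in> associated_primes (mpoly_ring n)
    (quotient_module (mpoly_ring n :: 'k::field mpoly ring) (mspan T))"
proof -
  have "p \<in> weight_ideal n C 1 \<longleftrightarrow> p \<in> carrier (mpoly_ring n) \<and> p * Poly_Mapping.single v 1 \<in> mspan T"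
    for p :: "'k mpoly"
  proof -
    have "p * Poly_Mapping.single v 1 \<in> mspan T \<longleftrightarrow> (\<forall>t\<in>keys p. t + v \<in> T)"
      by (rule mult_single_in_mspan_iff)
    moreover have "p \<in> carrier (mpoly_ring n) \<longleftrightarrow> (\<forall>t\<in>keys p. t \<in> exponents n)"
      by (auto simp: carrier_mpoly_ring mspan_def)
    moreover have "p \<in> weight_ideal n C 1 \<longleftrightarrow> (\<forall>t\<in>keys p. t \<in> exponents n \<and> 1 \<le> weight C t)"
      by (auto simp: weight_ideal_def mspan_def)
    ultimately show ?thesis using colon by blast
  qed
  moreover have "Poly_Mapping.single v 1 \<in> (carrier (mpoly_ring n) :: 'k mpoly set)"
    using v by (simp add: carrier_mpoly_ring single_in_mspan)
  ultimately show ?thesis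
    by (subst associated_primes_quotient_module[OF cring_mpoly_ring ideal_mspan[OF T]])
      (intro conjI primeideal_weight_ideal bexI[of _ "Poly_Mapping.single v 1"], auto)
qed

text \<open>
  Truncating at \<open>k\<close> bounds the size of a monomial without affecting membership in the \<open>k\<close>-th power,
  so a multiple of \<open>u\<close> outside that power and of largest truncated degree exists. For such a monomial
  each variable either multiplies it into the power or already has an exponent of at least \<open>k\<close>.
\<close>

lemma maximal_exponent_outside_edge_power:
  assumes u: "u \<in> exponents n" "u \<notin> edge_power n E k"
  shows "\<exists>v s. v = u + s \<and> v \<in> exponents n \<and> v \<notin> edge_power n E k \<and>
    (\<forall>i\<in>{1..n}. v + expo {i} 1 \<in> edge_power n E k \<or> k \<le> lookup v i)"
proof -
  let ?Q = "\<lambda>v. (\<exists>s. v = u + s) \<and> v \<in> exponents n \<and> v \<notin> edge_power n E k"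
  let ?f = "\<lambda>v. \<Sum>i\<in>{1..n}. min (lookup v i) k"
  have bound: "?f v < n * k + 1" for v
    using sum_bounded_above[of "{1..n}" "\<lambda>i. min (lookup v i) k" k] by simp
  have Qu: "?Q u" using u by (auto intro!: exI[of _ 0])
  obtain v where v: "?Q v" "\<And>w. ?Q w \<Longrightarrow> ?f w \<le> ?f v"
    using ex_has_greatest_nat[of ?Q u ?f "n * k + 1"] Qu bound by (metis less_imp_le)
  have "v + expo {i} 1 \<in> edge_power n E k \<or> k \<le> lookup v i" if i: "i \<in> {1..n}" for i
  proof (rule ccontr)
    assume c: "\<not> ?thesis"
    have "?Q (v + expo {i} 1)"
      using v(1) c i expo_in_exponents[of "{i}" n 1] by (auto simp: add.assoc)
    then have "?f (v + expo {i} 1) \<le> ?f v" by (rule v(2))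
    moreover have "?f v < ?f (v + expo {i} 1)"
    proof (rule sum_strict_mono_ex1)
      show "\<exists>j\<in>{1..n}. min (lookup v j) k < min (lookup (v + expo {i} 1) j) k"
        using c i by (intro bexI[of _ i]) (auto simp: lookup_add lookup_expo)
    qed (auto simp: lookup_add)
    ultimately show False by simp
  qed
  then show ?thesis using v(1) by blast
qed

text \<open>
  Suppose that \<open>u\<close> has degree at least \<open>k\<close> on all covers and is not in \<open>J\<^sup>k\<close>. For a maximal multiple
  \<open>v\<close> of \<open>u\<close> outside \<open>J\<^sup>k\<close>, the colon of \<open>J\<^sup>k\<close> by \<open>v\<close> is the prime of the set \<open>A\<close> of those variables that
  multiply \<open>v\<close> into \<open>J\<^sup>k\<close>. By hypothesis this prime is also associated to \<open>J\<close>, say as the colon by \<open>g\<close>;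
  in particular it contains \<open>J\<close>, so \<open>A\<close> is a cover and \<open>v\<close> has degree at least \<open>k\<close> in \<open>A\<close>.

  A monomial \<open>w\<close> of \<open>g\<close> outside \<open>J\<close> shows that every vertex of \<open>A\<close> has an edge of its own: the support
  of \<open>w\<close> contains no edge and is disjoint from \<open>A\<close>, but acquires an edge when a vertex of \<open>A\<close> is added.
  As \<open>v\<close> has exponents of at least \<open>k\<close> outside \<open>A\<close>, these edges force \<open>v\<close> into \<open>J\<^sup>k\<close>.
\<close>

lemma torsion_free_if_normally_torsion_free:
  assumes ntf: "normally_torsion_free (mpoly_ring n) (mspan (edge_multiples n E) :: 'k::field mpoly set)"
    and E: "E \<subseteq> Pow {1..n}"
  shows "torsion_free n E"
  unfolding torsion_free_def
proof (intro allI ballI impI, rule ccontr)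
  fix k u
  assume u: "u \<in> exponents n" and wu: "\<forall>C. cover n E C \<longrightarrow> k \<le> weight C u"
    and notin: "u \<notin> edge_power n E k"
  let ?R = "mpoly_ring n :: 'k mpoly ring"
  have k: "1 \<le> k" using notin u by (cases k) auto
  obtain v s where v: "v = u + s" "v \<in> exponents n" "v \<notin> edge_power n E k"
    "\<And>i. i \<in> {1..n} \<Longrightarrow> v + expo {i} 1 \<in> edge_power n E k \<or> k \<le> lookup v i"
    using maximal_exponent_outside_edge_power[OF u notin] by blast
  define A where "A = {i \<in> {1..n}. v + expo {i} 1 \<in> edge_power n E k}"
  have A: "A \<subseteq> {1..n}" "finite A" by (auto simp: A_def)
  have big: "k \<le> lookup v j" if "j \<in> {1..n} - A" for j
    using that v(4) by (auto simp: A_def)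
  have in_iff: "t + v \<in> edge_power n E k \<longleftrightarrow> 1 \<le> weight A t" if t: "t \<in> exponents n" for t
  proof
    assume "1 \<le> weight A t"
    then have "weight A t \<noteq> 0" by simp
    then obtain i where i: "i \<in> A" "i \<in> keys t" using A(2) by (auto simp: weight_def in_keys_iff)
    have eq: "expo {i} 1 + (t - expo {i} 1) = t" using i(2) by (intro expo_add_diff) simp
    then have "t - expo {i} 1 \<in> exponents n" using t by (metis exponents_add_iff)
    then have "(v + expo {i} 1) + (t - expo {i} 1) \<in> edge_power n E k"
      using i(1) edge_power_up unfolding A_def by blast
    then show "t + v \<in> edge_power n E k" using eq by (metis add.assoc add.commute)
  next
    assume tv: "t + v \<in> edge_power n E k"
    show "1 \<le> weight A t"
    proof (rule ccontr)
      assume "\<not> 1 \<le> weight A t"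
      then have "weight A t = 0" by simp
      then have zero: "lookup t i = 0" if "i \<in> A" for i
        using that A(2) by (simp add: weight_def)
      have "min (lookup (t + v) i) k \<le> lookup v i" for i
      proof -
        consider "i \<in> A" | "i \<in> {1..n} - A" | "i \<notin> {1..n}" by blast
        then show ?thesis
        proof cases
          case 3
          then have "lookup t i = 0" using t by (auto simp: exponents_def in_keys_iff)
          then show ?thesis by (simp add: lookup_add)
        qed (use zero big in \<open>auto simp: lookup_add min.coboundedI2\<close>)
      qed
      then have "v \<in> edge_power n E k" using edge_power_truncate[OF tv v(2)] by blast
      then show False using v(3) by simp
    qed
  qed
  let ?J = "mspan (edge_multiples n E) :: 'k mpoly set"
  have pow: "ideal_power ?R ?J k = mspan (edge_power n E k)" by (rule ideal_power_mspan)
  have "weight_ideal n A 1 \<in> associated_primes ?R (quotient_module ?R (ideal_power ?R ?J k))"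
    unfolding pow using upclosed_edge_power v(2) in_iff by (rule weight_ideal_associated_prime)
  then have "weight_ideal n A 1 \<in> associated_primes ?R (quotient_module ?R ?J)"
    using ntf k unfolding normally_torsion_free_def by blast
  then obtain g where g: "g \<in> carrier ?R"
    "weight_ideal n A 1 = {r \<in> carrier ?R. r * g \<in> ?J}"
    by (subst (asm) associated_primes_quotient_module[OF cring_mpoly_ring])
      (auto intro!: ideal_mspan upclosed_edge_multiples)
  have "1 \<in> carrier ?R" by (simp add: carrier_mpoly_ring mspan_def)
  then have "g \<notin> ?J" using one_notin_weight_ideal[of n A, where 'k='k] g(2) by auto
  then obtain w where w: "w \<in> keys g" "w \<notin> edge_multiples n E" by (auto simp: mspan_def)
  have wn: "w \<in> exponents n" using g(1) w(1) by (auto simp: carrier_mpoly_ring mspan_def)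
  have own_edge: "\<exists>B\<in>E. B \<subseteq> {1..n} \<and> B \<inter> A = {i}" if i: "i \<in> A" for i
  proof -
    have shift: "w + expo {j} 1 \<in> edge_multiples n E" if j: "j \<in> A" for j
    proof -
      have "Poly_Mapping.single (expo {j} 1) 1 \<in> (weight_ideal n A 1 :: 'k mpoly set)"
        unfolding weight_ideal_def using j A
        by (intro single_in_mspan) (auto simp: weight_expo intro!: expo_in_exponents)
      then have "g * Poly_Mapping.single (expo {j} 1) 1 \<in> ?J" using g(2) by (simp add: mult.commute)
      then show ?thesis using w(1) by (simp only: mult_single_in_mspan_iff)
    qed
    have keys_shift: "keys (w + expo {j} 1) = insert j (keys w)" for j
      by (auto simp: keys_add_nat expo_def)
    have disj: "keys w \<inter> A = {}"
    proof (rule ccontr)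
      assume "keys w \<inter> A \<noteq> {}"
      then obtain j where j: "j \<in> keys w" "j \<in> A" by blast
      then have "w \<in> edge_multiples n E"
        using shift[OF j(2)] wn by (auto simp: edge_multiples_def keys_shift insert_absorb simp del: One_nat_def)
      then show False using w(2) by simp
    qed
    obtain B where B: "B \<in> E" "B \<subseteq> insert i (keys w)"
      using shift[OF i] by (auto simp: edge_multiples_def keys_shift simp del: One_nat_def)
    moreover have "\<not> B \<subseteq> keys w" using B(1) w(2) wn by (auto simp: edge_multiples_def)
    moreover have "insert i (keys w) \<subseteq> {1..n}" using wn i A(1) by (auto simp: exponents_def)
    ultimately show ?thesis using disj i by (intro bexI[of _ B]) auto
  qed
  have "cover n E A"
    unfolding cover_def
  proof (intro conjI ballI A(1))
    fix B assume B: "B \<in> E"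
    have Bn: "B \<subseteq> {1..n}" using B E by blast
    have "Poly_Mapping.single (expo B 1) 1 \<in> ?J"
      using expo_in_edge_multiples[OF B Bn] by (rule single_in_mspan)
    moreover have "expo B 1 \<in> exponents n" using Bn by (rule expo_in_exponents)
    ultimately have "Poly_Mapping.single (expo B 1) 1 \<in> (weight_ideal n A 1 :: 'k mpoly set)"
      using g ideal.I_r_closed[OF ideal_mspan[OF upclosed_edge_multiples], of _ n E g]
      by (simp add: carrier_mpoly_ring single_in_mspan)
    then have "1 \<le> weight A (expo B 1)" by (simp add: weight_ideal_def mspan_def)
    then show "B \<inter> A \<noteq> {}"
      using weight_expo[OF A(2) finite_subset[OF Bn], of 1] by (auto simp: Int_commute)

  qed
  then have "k \<le> weight A v" using wu v(1) by (metis weight_add trans_le_add1)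
  then have "v \<in> edge_power n E k"
    using edge_power_of_private_edges[OF A(1) own_edge v(2)] big by blast
  then show False using v(3) by simp
qed

lemma minimal_cover_below:
  assumes "cover n E C"
  shows "\<exists>D \<subseteq> C. cover n E D \<and> (\<forall>D'. cover n E D' \<longrightarrow> D' \<subseteq> D \<longrightarrow> D' = D)"
proof -
  have "finite {C. cover n E C}"
    by (rule finite_subset[of _ "Pow {1..n}"]) (auto simp: cover_def)
  from finite_has_minimal2[OF this, of C] assms show ?thesis by auto
qed

text \<open>
  Torsion-freeness writes \<open>J\<^sup>s\<close> as the intersection of the primary ideals \<open>P\<^sub>C\<^sup>s\<close> over the minimal
  covers \<open>C\<close>. If a prime \<open>P\<close> is the colon of \<open>J\<^sup>s\<close> by \<open>g\<close>, then \<open>P\<close> lies in \<open>P\<^sub>C\<close> for each \<open>C\<close> with \<open>g\<close>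
  outside \<open>P\<^sub>C\<^sup>s\<close>, and by prime avoidance it contains one of these \<open>P\<^sub>C\<close>; so it equals that one. And
  \<open>P\<^sub>C\<close> is associated to \<open>J\<close>, as the colon by the product of all variables outside \<open>C\<close>.
\<close>

lemma normally_torsion_free_if_torsion_free:
  assumes tf: "torsion_free n E" and E: "E \<subseteq> Pow {1..n}"
  shows "normally_torsion_free (mpoly_ring n) (mspan (edge_multiples n E) :: 'k::field mpoly set)"
proof -
  let ?R = "mpoly_ring n :: 'k mpoly ring"
  let ?J = "mspan (edge_multiples n E) :: 'k mpoly set"
  interpret R: cring ?R by (rule cring_mpoly_ring)
  define M where "M = {C. cover n E C \<and> (\<forall>D. cover n E D \<longrightarrow> D \<subseteq> C \<longrightarrow> D = C)}"
  have finM: "finite M"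
    by (rule finite_subset[of _ "Pow {1..n}"]) (auto simp: M_def cover_def)
  have powM: "p \<in> mspan (edge_power n E s) \<longleftrightarrow> (\<forall>C\<in>M. p \<in> weight_ideal n C s)"
    if p: "p \<in> carrier ?R" for p s
  proof
    assume "p \<in> mspan (edge_power n E s)"
    then show "\<forall>C\<in>M. p \<in> weight_ideal n C s"
      using weight_edge_power edge_power_subset by (fastforce simp: mspan_def weight_ideal_def M_def)
  next
    assume all: "\<forall>C\<in>M. p \<in> weight_ideal n C s"
    have "t \<in> edge_power n E s" if t: "t \<in> keys p" for t
    proof -
      have "s \<le> weight C t" if C: "cover n E C" for C
      proof -
        obtain D where D: "D \<subseteq> C" "D \<in> M" using minimal_cover_below[OF C] by (auto simp: M_def)
        then have "s \<le> weight D t" using all t by (auto simp: weight_ideal_def mspan_def)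
        also have "\<dots> \<le> weight C t"
          unfolding weight_def using C D(1) by (intro sum_mono2) (auto simp: cover_def intro: finite_subset)
        finally show ?thesis .
      qed
      moreover have "t \<in> exponents n" using p t by (auto simp: carrier_mpoly_ring mspan_def)
      ultimately show ?thesis using tf by (simp add: torsion_free_def)
    qed
    then show "p \<in> mspan (edge_power n E s)" by (auto simp: mspan_def)
  qed
  have minimal_prime: "weight_ideal n C 1 \<in> associated_primes ?R (quotient_module ?R ?J)"
    if C: "C \<in> M" for C
  proof -
    have cov: "cover n E C" and Cn: "C \<subseteq> {1..n}" using C by (auto simp: M_def cover_def)
    then have finC: "finite C" using finite_subset by blast
    define v where "v = expo ({1..n} - C) 1"
    have v: "v \<in> exponents n" unfolding v_def by (rule expo_in_exponents) auto
    have keys_v: "keys v = {1..n} - C" by (auto simp: v_def in_keys_iff lookup_expo split: if_splits)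
    have colon: "t + v \<in> edge_multiples n E \<longleftrightarrow> 1 \<le> weight C t" if t: "t \<in> exponents n" for t
    proof
      assume "t + v \<in> edge_multiples n E"
      then obtain B where B: "B \<in> E" "B \<subseteq> keys t \<union> keys v"
        by (auto simp: edge_multiples_def keys_add_nat)
      have "B \<inter> C \<noteq> {}" using cov B(1) by (simp add: cover_def)
      then obtain i where "i \<in> C" "i \<in> keys t" using B(2) keys_v by blast
      then show "1 \<le> weight C t"
        using finC member_le_sum[of i C "lookup t"] by (auto simp: weight_def in_keys_iff)
    next
      assume "1 \<le> weight C t"
      then have "weight C t \<noteq> 0" by simp
      then obtain i where i: "i \<in> C" "i \<in> keys t" using finC by (auto simp: weight_def in_keys_iff)
      have "\<not> cover n E (C - {i})" using C i(1) by (auto simp: M_def)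
      then obtain B where B: "B \<in> E" "B \<inter> (C - {i}) = {}" using Cn by (auto simp: cover_def)
      then have "B \<subseteq> keys (t + v)" using E i(2) by (auto simp: keys_add_nat keys_v)
      then show "t + v \<in> edge_multiples n E" using B(1) t v by (auto simp: edge_multiples_def)
    qed
    show ?thesis
      using upclosed_edge_multiples v colon by (rule weight_ideal_associated_prime)
  qed
  have "associated_primes ?R (quotient_module ?R (ideal_power ?R ?J s))
      \<subseteq> associated_primes ?R (quotient_module ?R ?J)" for s
  proof
    fix P :: "'k mpoly set"
    assume "P \<in> associated_primes ?R (quotient_module ?R (ideal_power ?R ?J s))"
    then obtain g where P: "primeideal P ?R" and g: "g \<in> carrier ?R"
      "P = {r \<in> carrier ?R. r * g \<in> mspan (edge_power n E s)}"
      unfolding ideal_power_mspan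
      by (subst (asm) associated_primes_quotient_module[OF cring_mpoly_ring])
        (auto intro!: ideal_mspan upclosed_edge_power)
    interpret P: primeideal P ?R by (rule P)
    have one: "1 \<notin> P" using P.I_notcarr P.one_imp_carrier by auto
    have P_iff: "r \<in> P \<longleftrightarrow> (\<forall>C\<in>M. r * g \<in> weight_ideal n C s)" if r: "r \<in> carrier ?R" for r
    proof -
      have "r \<in> P \<longleftrightarrow> r * g \<in> mspan (edge_power n E s)" by (subst g(2)) (simp add: r)
      then show ?thesis using powM[OF mpoly_ring_mult_closed[OF r g(1)]] by simp
    qed
    define M' where "M' = {C \<in> M. g \<notin> weight_ideal n C s}"
    have below: "P \<subseteq> weight_ideal n C 1" if C: "C \<in> M'" for C
    proof
      fix r assume r: "r \<in> P"
      then have rc: "r \<in> carrier ?R" by (rule P.Icarr)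
      show "r \<in> weight_ideal n C 1"
      proof (rule ccontr)
        assume "r \<notin> weight_ideal n C 1"
        moreover have "r * g \<in> weight_ideal n C s" using P_iff[OF rc] r C by (auto simp: M'_def)
        ultimately have "g \<in> weight_ideal n C s" using weight_ideal_primary[OF rc g(1)] by blast
        then show False using C by (simp add: M'_def)
      qed
    qed
    \<comment> \<open>Otherwise a product of elements of the ideals \<open>P\<^sub>C\<^sup>s\<close>, one for each \<open>C\<close> in \<open>M'\<close> and all outside
      \<open>P\<close>, would multiply \<open>g\<close> into \<open>J\<^sup>s\<close> and so belong to \<open>P\<close>.\<close>
    have "\<exists>C\<in>M'. weight_ideal n C 1 \<subseteq> P"
    proof (rule ccontr)
      assume none: "\<not> ?thesis"
      have avoid: "\<exists>x \<in> carrier ?R - P. x \<in> weight_ideal n C l" if C: "C \<in> M'" for C l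
      proof (induction l)
        case 0
        show ?case using one R.one_closed by (intro bexI[of _ 1]) (auto simp: weight_ideal_0)
      next
        case (Suc l)
        then obtain x where x: "x \<in> carrier ?R - P" "x \<in> weight_ideal n C l" by blast
        obtain y where y: "y \<in> weight_ideal n C 1" "y \<notin> P" using none C by blast
        have yc: "y \<in> carrier ?R" using ideal.Icarr[OF ideal_weight_ideal y(1)] .
        have "x * y \<in> weight_ideal n C (Suc l)" using weight_ideal_mult[OF x(2) y(1)] by simp
        moreover have "x * y \<in> carrier ?R" using x(1) yc mpoly_ring_mult_closed by blast
        moreover have "x * y \<notin> P" using P.I_prime[of x y] x(1) y(2) yc by auto
        ultimately show ?case by (intro bexI[of _ "x * y"]) auto
      qed
      have avoid_all: "\<exists>x \<in> carrier ?R - P. \<forall>C\<in>N. x \<in> weight_ideal n C s" if "finite N" "N \<subseteq> M'" for N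
        using that
      proof (induction N rule: finite_induct)
        case empty
        show ?case using one R.one_closed by auto
      next
        case (insert C N)
        then obtain x where x: "x \<in> carrier ?R - P" "\<forall>C\<in>N. x \<in> weight_ideal n C s" by blast
        obtain y where y: "y \<in> carrier ?R - P" "y \<in> weight_ideal n C s" using avoid insert.prems by blast
        have "x * y \<in> weight_ideal n D s" if "D \<in> insert C N" for D
        proof (cases "D = C")
          case True
          then show ?thesis
            using weight_ideal_mult[OF _ y(2), of x 0] x(1) by (simp add: weight_ideal_0)
        next
          case False
          then have "x \<in> weight_ideal n D s" using that x(2) by blast
          then show ?thesis
            using weight_ideal_mult[of x n D s y 0] y(1) by (simp add: weight_ideal_0)
        qed
        moreover have "x * y \<in> carrier ?R - P"
          using x(1) y(1) mpoly_ring_mult_closed[of x n y] P.I_prime[of x y] by auto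
        ultimately show ?case by (intro bexI[of _ "x * y"]) auto
      qed
      have "finite M'" using finM by (simp add: M'_def)
      then obtain x where x: "x \<in> carrier ?R - P" "\<forall>C\<in>M'. x \<in> weight_ideal n C s"
        using avoid_all[of M'] by blast
      have "x * g \<in> weight_ideal n C s" if C: "C \<in> M" for C
      proof (cases "C \<in> M'")
        case True
        then show ?thesis
          using x(2) weight_ideal_mult[of x n C s g 0] g(1) by (simp add: weight_ideal_0)
      next
        case False
        then show ?thesis
          using C x(1) weight_ideal_mult[of x n C 0 g s] by (simp add: weight_ideal_0 M'_def)
      qed
      then show False using P_iff x(1) by blast
    qed
    then obtain C where "C \<in> M'" "weight_ideal n C 1 = P" using below by blast
    then show "P \<in> associated_primes ?R (quotient_module ?R ?J)"
      using minimal_prime by (auto simp: M'_def)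
  qed
  then show ?thesis
    unfolding normally_torsion_free_def
    by (intro conjI allI impI ideal_mspan upclosed_edge_multiples)
qed


section \<open>Demotions and the enlarged ideal\<close>

lemma demotion_insert_edge:
  assumes tf: "torsion_free n E" and F: "F \<subseteq> {1..n}"
  shows "demotion (mpoly_ring n) (mspan (edge_multiples n E) :: 'k::field mpoly set)
    (mspan (edge_multiples n (insert F E)))"
proof -
  have sub: "mspan (edge_multiples n E) \<subseteq> (mspan (edge_multiples n (insert F E)) :: 'k mpoly set)"
    by (intro mspan_mono) (auto simp: edge_multiples_def)
  have "{a + b | a b. a \<in> edge_power n (insert F E) r \<and> b \<in> edge_power n E s}
      = edge_power n (insert F E) (r + s) \<inter> edge_power n E s" (is "?L = ?R") for r s
  proof
    show "?L \<subseteq> ?R"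
    proof
      fix t assume "t \<in> ?L"
      then obtain a b where ab: "t = a + b" "a \<in> edge_power n (insert F E) r" "b \<in> edge_power n E s"
        by blast
      have "b \<in> edge_power n (insert F E) s"
        using ab(3) edge_power_mono[of E "insert F E" n n] by blast
      moreover have "b + a \<in> edge_power n E s"
        using ab edge_power_up edge_power_subset by blast
      ultimately show "t \<in> ?R" using ab edge_power_add by (auto simp: add.commute)
    qed
    show "?R \<subseteq> ?L" using edge_power_insert_Int[OF tf F] by blast
  qed
  then show ?thesis
    unfolding demotion_def ideal_power_mspan
    by (auto simp: ideal_prod_mspan upclosed_edge_power mspan_Int[symmetric] sub
        intro!: ideal_mspan upclosed_edge_multiples)
qed

theorem theorem6p3:
  fixes I J :: "'k::field mpoly set" and n m \<alpha> \<beta> :: nat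
  assumes "squarefree_monomial_ideal n I"
    and "squarefree_monomial_ideal n J"
    and "\<alpha> \<in> {1..n}" and "\<beta> \<in> {1..n}" and "\<alpha> \<noteq> \<beta>"
    and "I = J <+>\<^bsub>mpoly_ring n\<^esub> PIdl\<^bsub>mpoly_ring n\<^esub> (var \<alpha> * var \<beta>)"
  shows "(var \<alpha> * var \<beta> \<notin> J \<longrightarrow> normally_torsion_free (mpoly_ring n) J
            \<longrightarrow> proper_demotion (mpoly_ring n) J I) \<and>
         (normally_torsion_free (mpoly_ring n) I \<and> normally_torsion_free (mpoly_ring n) J \<longrightarrow>
            (let h = (\<Prod>i = 1..m. var (n + i));
                 S = mpoly_ring (n + m);
                 L = Idl\<^bsub>S\<^esub> J <+>\<^bsub>S\<^esub> PIdl\<^bsub>S\<^esub> (h * var \<alpha> * var \<beta>)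
             in squarefree_monomial_ideal (n + m) L \<and> normally_torsion_free S L))"
proof -
  obtain E where E: "E \<subseteq> Pow {1..n}" and J: "J = mspan (edge_multiples n E)"
    using assms(2) by (auto simp: squarefree_monomial_ideal_iff)
  define F where "F = {\<alpha>, \<beta>}"
  have F: "F \<subseteq> {1..n}" using assms(3,4) by (simp add: F_def)
  have f: "var \<alpha> * var \<beta> = (\<Prod>i\<in>F. var i :: 'k mpoly)" using assms(5) by (simp add: F_def)
  have I: "I = mspan (edge_multiples n (insert F E))"
    using assms(6) add_principal_eq_mspan[OF E F] by (simp add: J f)
  have "proper_demotion (mpoly_ring n) J I"
    if "var \<alpha> * var \<beta> \<notin> J" "normally_torsion_free (mpoly_ring n) J"
  proof -
    have "demotion (mpoly_ring n) J I"
      using that(2) E F unfolding I J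
      by (intro demotion_insert_edge torsion_free_if_normally_torsion_free)
    moreover have "var \<alpha> * var \<beta> \<in> I"
      using expo_in_edge_multiples[of F "insert F E" n] F unfolding f prod_var I
      by (intro single_in_mspan) blast
    ultimately show ?thesis using that(1) by (auto simp: proper_demotion_def)
  qed
  moreover have "squarefree_monomial_ideal (n + m) L \<and> normally_torsion_free (mpoly_ring (n + m)) L"
    if ntf: "normally_torsion_free (mpoly_ring n) I" "normally_torsion_free (mpoly_ring n) J"
      and L: "L = Idl\<^bsub>mpoly_ring (n + m)\<^esub> J <+>\<^bsub>mpoly_ring (n + m)\<^esub>
        PIdl\<^bsub>mpoly_ring (n + m)\<^esub> ((\<Prod>i = 1..m. var (n + i)) * var \<alpha> * var \<beta>)" for L
  proof -
    define H where "H = {Suc n..n + m}"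
    have "(\<Prod>i = 1..m. var (n + i)) = (\<Prod>i\<in>H. var i :: 'k mpoly)"
      unfolding H_def using prod.shift_bounds_cl_nat_ivl[of var 1 n m, symmetric]
      by (simp add: add.commute)
    then have hf: "(\<Prod>i = 1..m. var (n + i)) * var \<alpha> * var \<beta> = (\<Prod>i\<in>F \<union> H. var i :: 'k mpoly)"
      using f F by (subst prod.union_disjoint) (auto simp: F_def H_def mult_ac)
    have EN: "E \<subseteq> Pow {1..n + m}" using E by fastforce
    have FN: "F \<union> H \<subseteq> {1..n + m}" using F by (auto simp: H_def)
    have L': "L = mspan (edge_multiples (n + m) (insert (F \<union> H) E))"
      unfolding L J hf genideal_extend[OF E le_add1] using EN FN by (rule add_principal_eq_mspan)
    have EFN: "insert (F \<union> H) E \<subseteq> Pow {1..n + m}" using EN FN by simp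
    have "torsion_free n E" "torsion_free n (insert F E)"
      using ntf E F unfolding I J by (simp_all add: torsion_free_if_normally_torsion_free)
    then have "torsion_free (n + m) (insert (F \<union> H) E)"
      using F unfolding H_def by (rule torsion_free_enlarge_edge)
    then have "normally_torsion_free (mpoly_ring (n + m)) L"
      unfolding L' using EFN by (rule normally_torsion_free_if_torsion_free)
    then show ?thesis unfolding squarefree_monomial_ideal_iff using EFN L' by blast
  qed
  ultimately show ?thesis by (simp add: Let_def)
qed

end
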